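(* Let $A_0,A_1\in\mathbb{M}^3$, define $A_\infty(t)=A_0+tA_1$, and assume that $\lim_{t\to\infty}\det A_\infty(t)=+\infty$. If $\gamma>5$, then the equation $$A''(t)=(\det A(t))^{1-\gamma}A(t)^{-\top}$$ has a unique solution $A\in C(\mathbb{R},\mathrm{GL}^+(3,\mathbb{R}))\cap C^\infty(\mathbb{R},\mathbb{M}^3)$ such that $$\lim_{t\to\infty}\|A(t)-A_\infty(t)\|=0.$$
   Context: $\mathbb{M}^3$ is the space of real $3\times3$ matrices with operator norm $\|\cdot\|$, $\mathrm{GL}^+(3,\mathbb{R})=\{A\in\mathbb{M}^3:\det A>0\}$, $A^{-\top}=(A^{-1})^\top$. *)

theory Defs
  imports "HOL-Analysis.Analysis"
begin

(* The library norm on real^3^3 is the Frobenius norm; this is the operator norm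
   induced by the Euclidean norm on real^3. *)
definition opnorm :: "real^3^3 \<Rightarrow> real" where
  "opnorm M = onorm (\<lambda>x. M *v x)"

definition GL_pos :: "(real^3^3) set" where
  "GL_pos = {A. det A > 0}"

definition inverse_transpose :: "real^3^3 \<Rightarrow> real^3^3" where
  "inverse_transpose A = transpose (matrix_inv A)"

definition vderiv :: "(real \<Rightarrow> 'a::real_normed_vector) \<Rightarrow> real \<Rightarrow> 'a" where
  "vderiv f = (\<lambda>t. vector_derivative f (at t))"

(* Derivatives of all orders exist everywhere; their continuity is then automatic. *)
definition C_infinity :: "(real \<Rightarrow> 'a::real_normed_vector) \<Rightarrow> bool" where
  "C_infinity f \<longleftrightarrow> (\<forall>n t. (vderiv ^^ n) f differentiable (at t))"

end

theory Submission
  imports Defs "HOL-Real_Asymp.Real_Asymp"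
begin

text \<open>
  Write \<open>A\<^sub>\<infinity> t = A0 + t A1\<close>, \<open>B = A - A\<^sub>\<infinity>\<close> and \<open>F X = (det X)\<^bsup>-\<gamma>\<^esup> cof X\<close>; for \<open>det X > 0\<close> the equation reads
  \<open>A'' = F A\<close>.  The determinant of \<open>A\<^sub>\<infinity>\<close> is a cubic polynomial in \<open>t\<close> that tends to infinity, so it is
  at least \<open>k t\<close> for large \<open>t\<close>.  This rate can be attained while the cofactor matrix of \<open>A\<^sub>\<infinity>\<close> grows like
  \<open>t\<^sup>2\<close>, and everything below is tuned to that worst case.

  \<^emph>\<open>Existence near infinity.\<close>  Where the determinant is at least \<open>c t\<close> and the norm at most \<open>C t\<close>, the force
  is \<open>O(t\<^bsup>2-\<gamma>\<^esup>)\<close> with Lipschitz constant \<open>O(t\<^bsup>3-\<gamma>\<^esup>)\<close>.  Integrating twice from infinity turns the latter into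
  \<open>O(t\<^bsup>5-\<gamma>\<^esup>)\<close>, which tends to zero exactly because \<open>\<gamma> > 5\<close>: the integral equation for \<open>B\<close> is a contraction on
  a half-line \<open>[T, \<infinity>)\<close> (\<open>terminal_value_solution\<close>).  The solution satisfies \<open>B = O(t\<^bsup>4-\<gamma>\<^esup>)\<close>, so the change of
  the determinant, \<open>O(t\<^sup>2 \<bar>B\<bar>)\<close>, is \<open>o(t)\<close> and the artificial cut-offs are inactive for large \<open>t\<close>
  (\<open>exists_asymptotic_solution\<close>).

  \<^emph>\<open>Extension to the whole line.\<close>  The force is minus the gradient of \<open>(det X)\<^bsup>1-\<gamma>\<^esup> / (\<gamma> - 1)\<close>, a positive
  potential that blows up where the determinant vanishes.  Conservation of energy therefore bounds the speed
  and keeps the determinant away from zero, and no solution can break down in finite time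
  (\<open>global_solution\<close>).

  \<^emph>\<open>Uniqueness.\<close>  Knowing only \<open>B \<rightarrow> 0\<close>, the term \<open>cof A\<^sub>\<infinity> \<bullet> B \<approx> t\<^sup>2 (cof A1 \<bullet> B)\<close> could destroy the lower bound on
  \<open>det A\<close>.  It cannot be negative, however: \<open>h = cof A1 \<bullet> B\<close> satisfies \<open>h'' = (det A)\<^bsup>-\<gamma>\<^esup> (cof A1 \<bullet> cof A) \<ge> 0\<close> for
  large \<open>t\<close>, and a convex function that tends to zero is nonnegative.  Hence \<open>det A \<ge> k t / 2\<close> eventually
  (\<open>solution_det_growth\<close>), the Lipschitz estimate applies to the difference of two solutions, and the same double
  integration shows that they agree near infinity; a Gronwall argument (\<open>solutions_agree\<close>) carries the
  agreement back to all times.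
\<close>

section \<open>Estimates for antiderivatives on half-lines\<close>

lemma antiderivative_exists:
  fixes g :: "real \<Rightarrow> 'a::euclidean_space"
  assumes "continuous_on UNIV g"
  obtains Q where "\<And>t. (Q has_vector_derivative g t) (at t)" "Q t0 = y0"
proof -
  have "\<exists>F. \<forall>x::real. -\<infinity> < ereal x \<longrightarrow> ereal x < \<infinity> \<longrightarrow> (F has_vector_derivative g x) (at x)"
    using assms by (intro einterval_antiderivative) (auto simp: continuous_on_eq_continuous_at)
  then obtain F where F: "\<And>x. (F has_vector_derivative g x) (at x)" by auto
  show ?thesis
  proof
    show "((\<lambda>t. F t - F t0 + y0) has_vector_derivative g t) (at t)" for t
      using F[of t] by (auto intro!: derivative_eq_intros)
  qed auto
qed

lemma has_vector_derivative_imp_continuous_on: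
  assumes "\<And>t. t \<in> S \<Longrightarrow> (f has_vector_derivative f' t) (at t)"
  shows "continuous_on S f"
  by (rule continuous_at_imp_continuous_on) (use assms has_vector_derivative_continuous in blast)

lemma mean_value_comparison:
  fixes f :: "real \<Rightarrow> 'a::real_normed_vector"
  assumes "a \<le> b"
    and "\<And>x. a \<le> x \<Longrightarrow> x \<le> b \<Longrightarrow> (f has_vector_derivative f' x) (at x)"
    and "\<And>x. a \<le> x \<Longrightarrow> x \<le> b \<Longrightarrow> (\<phi> has_real_derivative \<phi>' x) (at x)"
    and "\<And>x. a \<le> x \<Longrightarrow> x \<le> b \<Longrightarrow> norm (f' x) \<le> \<phi>' x"
  shows "norm (f b - f a) \<le> \<phi> b - \<phi> a"
proof (cases "a = b")
  case False
  show ?thesis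
  proof (rule differentiable_bound_general[where f' = f' and \<phi>' = \<phi>'])
    show "continuous_on {a..b} f"
      by (rule has_vector_derivative_imp_continuous_on[of _ _ f']) (use assms in auto)
    show "continuous_on {a..b} \<phi>"
      by (rule has_vector_derivative_imp_continuous_on[of _ _ \<phi>'])
        (use assms in \<open>auto simp: has_real_derivative_iff_has_vector_derivative[symmetric]\<close>)
  qed (use assms False in \<open>auto simp: has_real_derivative_iff_has_vector_derivative[symmetric]\<close>)
qed auto

text \<open>
  The function \<open>- C / (p - 1) t\<^bsup>1-p\<^esup>\<close> is an antiderivative of the bound, and it increases towards zero.
\<close>

lemma increment_bound_power_decay:
  fixes Q :: "real \<Rightarrow> 'a::real_normed_vector"
  assumes "T > 0" "p > 1" "T \<le> s" "s \<le> t"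
    and "\<And>t. t \<ge> T \<Longrightarrow> (Q has_vector_derivative G t) (at t)"
    and "\<And>t. t \<ge> T \<Longrightarrow> norm (G t) \<le> C * t powr (- p)"
  shows "norm (Q t - Q s) \<le> C / (p - 1) * s powr (1 - p)"
proof -
  have "C \<ge> 0"
    using assms(6)[of T] \<open>T > 0\<close> norm_ge_zero[of "G T"]
    by (smt (verit) powr_gt_zero zero_le_mult_iff)
  have "norm (Q t - Q s) \<le> (- (C / (p - 1) * t powr (1 - p))) - (- (C / (p - 1) * s powr (1 - p)))"
  proof (rule mean_value_comparison[where f' = G and \<phi>' = "\<lambda>t. C * t powr (- p)"])
    fix x assume "s \<le> x"
    then have "x > 0" using assms by linarith
    then have "((\<lambda>t. - (C / (p - 1) * t powr (1 - p))) has_real_derivative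
        - (C / (p - 1) * ((1 - p) * x powr (1 - p - 1)))) (at x)"
      by (intro DERIV_minus DERIV_cmult has_real_derivative_powr)
    moreover have "- (C / (p - 1) * ((1 - p) * x powr (1 - p - 1))) = C * x powr - p"
      using \<open>p > 1\<close> by (simp add: divide_simps) (simp add: algebra_simps)
    ultimately show "((\<lambda>t. - (C / (p - 1) * t powr (1 - p))) has_real_derivative C * x powr - p) (at x)"
      by simp
  qed (use assms in auto)
  also have "\<dots> \<le> C / (p - 1) * s powr (1 - p)"
    using \<open>C \<ge> 0\<close> \<open>p > 1\<close> by simp
  finally show ?thesis .
qed

lemma powr_decay_at_top: "a < 0 \<Longrightarrow> ((\<lambda>t::real. C * t powr a) \<longlongrightarrow> 0) at_top"
  using tendsto_mult_right_zero[OF tendsto_neg_powr[OF _ filterlim_ident]] by simp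

lemma tail_bound_power_decay:
  fixes Q :: "real \<Rightarrow> 'a::real_normed_vector"
  assumes "T > 0" "p > 1" "(Q \<longlongrightarrow> L) at_top"
    and "\<And>t. t \<ge> T \<Longrightarrow> (Q has_vector_derivative G t) (at t)"
    and "\<And>t. t \<ge> T \<Longrightarrow> norm (G t) \<le> C * t powr (- p)"
    and "t \<ge> T"
  shows "norm (Q t - L) \<le> C / (p - 1) * t powr (1 - p)"
proof -
  have "\<forall>\<^sub>F s in at_top. norm (Q s - Q t) \<le> C / (p - 1) * t powr (1 - p)"
    using eventually_ge_at_top[of t]
    by eventually_elim (use increment_bound_power_decay[of T p t] assms in auto)
  moreover have "((\<lambda>s. norm (Q s - Q t)) \<longlongrightarrow> norm (L - Q t)) at_top"
    by (intro tendsto_intros assms)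
  ultimately have "norm (L - Q t) \<le> C / (p - 1) * t powr (1 - p)"
    by (intro tendsto_upperbound[OF _ _ trivial_limit_at_top_linorder])
  then show ?thesis by (simp add: norm_minus_commute)
qed

text \<open>
  Any antiderivative satisfies the Cauchy criterion at infinity by the increment bound; subtracting its
  limit normalises it.
\<close>

lemma antiderivative_vanishing_at_infinity:
  fixes g :: "real \<Rightarrow> 'a::euclidean_space"
  assumes "continuous_on UNIV g" "T > 0" "p > 1"
    and bound: "\<And>t. t \<ge> T \<Longrightarrow> norm (g t) \<le> C * t powr (- p)"
  obtains Q where "\<And>t. (Q has_vector_derivative g t) (at t)" "(Q \<longlongrightarrow> 0) at_top"
proof -
  obtain F where F: "\<And>t. (F has_vector_derivative g t) (at t)"
    using antiderivative_exists[OF assms(1)] by blast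
  have inc: "norm (F t - F s) \<le> C / (p - 1) * s powr (1 - p)" if "T \<le> s" "s \<le> t" for s t
    using increment_bound_power_decay[OF assms(2,3) that F bound] .
  have lim0: "((\<lambda>s. C / (p - 1) * s powr (1 - p)) \<longlongrightarrow> 0) at_top"
    using \<open>p > 1\<close> by (intro powr_decay_at_top) auto
  have "cauchy_filter (filtermap F at_top)"
    unfolding cauchy_filter_metric_filtermap
  proof (intro allI impI)
    fix e :: real assume "e > 0"
    then have "\<forall>\<^sub>F s in at_top. C / (p - 1) * s powr (1 - p) < e / 2 \<and> s \<ge> T"
      using order_tendstoD(2)[OF lim0, of "e/2"] eventually_ge_at_top[of T] by (simp add: eventually_conj)
    then obtain s where s: "C / (p - 1) * s powr (1 - p) < e / 2" "s \<ge> T"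
      using eventually_happens[of _ "at_top :: real filter"] by auto
    have near: "dist (F t) (F s) < e / 2" if "t \<ge> s" for t
      using inc[OF s(2) that] s(1) unfolding dist_norm by (rule le_less_trans)
    show "\<exists>P. eventually P at_top \<and> (\<forall>x y. P x \<and> P y \<longrightarrow> dist (F x) (F y) < e)"
    proof (intro exI[of _ "\<lambda>t. t \<ge> s"] conjI allI impI)
      fix x y assume "s \<le> x \<and> s \<le> y"
      then show "dist (F x) (F y) < e"
        using near[of x] near[of y] dist_triangle_half_r[of "F s" "F x" e "F y"]
        by (simp add: dist_commute)
    qed (rule eventually_ge_at_top)
  qed
  then have "\<exists>L\<in>UNIV. filtermap F at_top \<le> nhds L"
    using complete_UNIV[unfolded complete_uniform, rule_format, of "filtermap F at_top"]
    by (simp add: filtermap_bot_iff)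
  then obtain L where L: "(F \<longlongrightarrow> L) at_top"
    by (auto simp: filterlim_def)
  show ?thesis
  proof
    show "((\<lambda>t. F t - L) has_vector_derivative g t) (at t)" for t
      using F[of t] by (auto intro!: derivative_eq_intros)
    show "((\<lambda>t. F t - L) \<longlongrightarrow> 0) at_top" using L by (simp add: LIM_zero)
  qed
qed

lemma double_tail_bound:
  fixes B :: "real \<Rightarrow> 'a::real_normed_vector"
  assumes "T > 0" "p > 2" "(B' \<longlongrightarrow> 0) at_top" "(B \<longlongrightarrow> 0) at_top"
    and "\<And>t. t \<ge> T \<Longrightarrow> (B has_vector_derivative B' t) (at t)"
    and "\<And>t. t \<ge> T \<Longrightarrow> (B' has_vector_derivative G t) (at t)"
    and "\<And>t. t \<ge> T \<Longrightarrow> norm (G t) \<le> C * t powr (- p)"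
    and "t \<ge> T"
  shows "norm (B t) \<le> C / ((p - 1) * (p - 2)) * t powr (2 - p)"
proof -
  have "norm (B' t) \<le> C / (p - 1) * t powr (- (p - 1))" if "t \<ge> T" for t
    using tail_bound_power_decay[of T p B' 0 G C t] assms that by simp
  then have "norm (B t) \<le> C / (p - 1) / ((p - 1) - 1) * t powr (1 - (p - 1))"
    using tail_bound_power_decay[of T "p - 1" B 0 B' "C / (p - 1)" t] assms by simp
  then show ?thesis by simp
qed

text \<open>
  A small second derivative makes \<open>B'\<close> almost constant on \<open>[t, t + 1]\<close>, hence almost equal to the increment
  \<open>B (t + 1) - B t\<close>, which is small.
\<close>

lemma derivative_vanishes_at_infinity:
  fixes B :: "real \<Rightarrow> 'a::real_normed_vector"
  assumes "(B \<longlongrightarrow> 0) at_top" "(G \<longlongrightarrow> 0) at_top"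
    and "\<And>t. t \<ge> T \<Longrightarrow> (B has_vector_derivative B' t) (at t)"
    and "\<And>t. t \<ge> T \<Longrightarrow> (B' has_vector_derivative G t) (at t)"
  shows "(B' \<longlongrightarrow> 0) at_top"
proof (rule tendstoI)
  fix e :: real assume "e > 0"
  then have "\<forall>\<^sub>F t in at_top. norm (B t) < e / 4" "\<forall>\<^sub>F t in at_top. norm (G t) < e / 4"
    using tendstoD[OF assms(1), of "e/4"] tendstoD[OF assms(2), of "e/4"] by auto
  then have "\<forall>\<^sub>F t in at_top. norm (B t) < e / 4 \<and> norm (G t) < e / 4"
    by (rule eventually_conj)
  then obtain N where N: "\<And>t. t \<ge> N \<Longrightarrow> norm (B t) < e / 4" "\<And>t. t \<ge> N \<Longrightarrow> norm (G t) < e / 4"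
    unfolding eventually_at_top_linorder by auto
  have "norm (B' t) < e" if "t \<ge> max N T" for t
  proof -
    have "norm (B' s - B' t) \<le> e / 4" if "t \<le> s" "s \<le> t + 1" for s
    proof -
      have "norm (B' s - B' t) \<le> e / 4 * s - e / 4 * t"
        by (rule mean_value_comparison[where f' = G and \<phi>' = "\<lambda>_. e / 4"])
          (use \<open>t \<ge> max N T\<close> that assms N in \<open>auto intro!: derivative_eq_intros less_imp_le\<close>)
      also have "\<dots> = e / 4 * (s - t)" by (simp add: algebra_simps)
      also have "\<dots> \<le> e / 4 * 1" using that \<open>e > 0\<close> by (intro mult_left_mono) auto
      finally show ?thesis by simp
    qed
    then have "norm ((B (t + 1) - (t + 1) *\<^sub>R B' t) - (B t - t *\<^sub>R B' t)) \<le> e / 4 * (t + 1) - e / 4 * t"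
      by (intro mean_value_comparison[where f' = "\<lambda>s. B' s - B' t" and \<phi>' = "\<lambda>_. e / 4"])
        (use \<open>t \<ge> max N T\<close> assms in \<open>auto intro!: derivative_eq_intros\<close>)
    then have "norm (B (t + 1) - B t - B' t) \<le> e / 4"
      by (simp add: algebra_simps)
    moreover have "norm (B (t + 1)) < e / 4" "norm (B t) < e / 4" using N that by auto
    moreover have "B' t = B (t + 1) - B t - (B (t + 1) - B t - B' t)" by simp
    ultimately show ?thesis
      using norm_triangle_ineq4[of "B (t + 1) - B t" "B (t + 1) - B t - B' t"]
        norm_triangle_ineq4[of "B (t + 1)" "B t"] \<open>e > 0\<close> by simp
  qed
  then show "\<forall>\<^sub>F t in at_top. dist (B' t) 0 < e"
    unfolding eventually_at_top_linorder by (auto intro!: exI[of _ "max N T"])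
qed

text \<open>
  The derivative is nondecreasing.  If it were positive anywhere, \<open>h\<close> would grow at least linearly; so \<open>h\<close>
  decreases to its limit zero.
\<close>

lemma eventually_convex_decay_nonneg:
  fixes h :: "real \<Rightarrow> real"
  assumes "(h \<longlongrightarrow> 0) at_top"
    and "\<And>t. t \<ge> T \<Longrightarrow> (h has_real_derivative h' t) (at t)"
    and "\<And>t. t \<ge> T \<Longrightarrow> (h' has_real_derivative h'' t) (at t)"
    and "\<And>t. t \<ge> T \<Longrightarrow> h'' t \<ge> 0" and "t \<ge> T"
  shows "h t \<ge> 0"
proof -
  have mono: "h' s \<le> h' u" if "T \<le> s" "s \<le> u" for s u
    by (rule DERIV_nonneg_imp_nondecreasing[OF that(2)]) (use assms(3,4) that in \<open>meson order_trans\<close>)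
  have neg: "h' s \<le> 0" if "s \<ge> T" for s
  proof (rule ccontr)
    assume "\<not> h' s \<le> 0"
    then have pos: "h' s > 0" by simp
    have "h s + h' s * (u - s) \<le> h u" if "u \<ge> s" for u
    proof -
      have "(\<lambda>u. h u - h' s * u) s \<le> (\<lambda>u. h u - h' s * u) u"
      proof (rule DERIV_nonneg_imp_nondecreasing[OF that], intro exI conjI)
        fix x assume "s \<le> x"
        then show "((\<lambda>u. h u - h' s * u) has_real_derivative h' x - h' s) (at x)" "h' x - h' s \<ge> 0"
          using assms(2)[of x] mono[of s x] \<open>s \<ge> T\<close> by (auto intro!: derivative_eq_intros)
      qed
      then show ?thesis by (simp add: algebra_simps)
    qed
    then have "\<forall>\<^sub>F u in at_top. h s + h' s * (u - s) \<le> h u"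
      by (rule eventually_mono[OF eventually_ge_at_top[of s]])
    moreover have "filterlim (\<lambda>u. h s + h' s * (u - s)) at_top at_top"
      using pos by real_asymp
    ultimately have "filterlim h at_top at_top"
      using filterlim_at_top_mono by blast
    then show False
      using not_tendsto_and_filterlim_at_infinity[OF _ assms(1)] filterlim_at_top_imp_at_infinity
        trivial_limit_at_top_linorder by blast
  qed
  have "h u \<le> h t" if "u \<ge> t" for u
    by (rule DERIV_nonpos_imp_nonincreasing[OF that]) (use assms(2) neg \<open>t \<ge> T\<close> in \<open>meson order_trans\<close>)
  then have "\<forall>\<^sub>F u in at_top. h u \<le> h t"
    by (rule eventually_mono[OF eventually_ge_at_top[of t]])
  then show ?thesis using tendsto_upperbound[OF assms(1)] by simp
qed

section \<open>Solving ordinary differential equations by contraction\<close>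

lemma bcontfun_dist_val: "norm (apply_bcontfun u t - apply_bcontfun v t) \<le> dist u v"
  using dist_bounded[of u t v] by (simp add: dist_norm)

text \<open>
  The right-hand side integrates exactly, because \<open>l\<close> is the derivative of \<open>\<Lambda>\<close>; this makes the weight
  \<open>exp (2 \<bar>\<Lambda>\<bar>)\<close> gain the factor \<open>1/2\<close> in both directions of time.
\<close>

lemma exponential_weight_comparison:
  fixes D :: "real \<Rightarrow> 'a::real_normed_vector"
  assumes Lam: "\<And>t. (\<Lambda> has_real_derivative l t) (at t)" "\<Lambda> t0 = 0" "\<And>t. l t \<ge> 0"
    and D: "\<And>t. (D has_vector_derivative D' t) (at t)" "D t0 = 0"
    and bound: "\<And>t. norm (D' t) \<le> C * (l t * exp (2 * \<bar>\<Lambda> t\<bar>))"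
  shows "norm (D t) \<le> C / 2 * (exp (2 * \<bar>\<Lambda> t\<bar>) - 1)"
proof -
  have mono: "\<Lambda> s \<le> \<Lambda> u" if "s \<le> u" for s u
    by (rule DERIV_nonneg_imp_nondecreasing[OF that]) (use Lam in blast)
  show ?thesis
  proof (cases "t0 \<le> t")
    case True
    have "norm (D t - D t0) \<le> C / 2 * exp (2 * \<Lambda> t) - C / 2 * exp (2 * \<Lambda> t0)"
    proof (rule mean_value_comparison[OF True D(1)])
      fix x assume x: "t0 \<le> x"
      show "((\<lambda>t. C / 2 * exp (2 * \<Lambda> t)) has_real_derivative C * (l x * exp (2 * \<Lambda> x))) (at x)"
        by (auto intro!: derivative_eq_intros Lam(1))
      show "norm (D' x) \<le> C * (l x * exp (2 * \<Lambda> x))"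
        using bound[of x] mono[OF x] Lam(2) by simp
    qed
    then show ?thesis using mono[OF True] Lam(2) D(2) by (simp add: algebra_simps)
  next
    case False
    then have le: "t \<le> t0" by simp
    have "norm (D t0 - D t) \<le> (- (C / 2 * exp (- 2 * \<Lambda> t0))) - (- (C / 2 * exp (- 2 * \<Lambda> t)))"
    proof (rule mean_value_comparison[OF le D(1)])
      fix x assume x: "x \<le> t0"
      show "((\<lambda>t. - (C / 2 * exp (- 2 * \<Lambda> t))) has_real_derivative C * (l x * exp (- 2 * \<Lambda> x))) (at x)"
        by (auto intro!: derivative_eq_intros Lam(1))
      show "norm (D' x) \<le> C * (l x * exp (- 2 * \<Lambda> x))"
        using bound[of x] mono[OF x] Lam(2) by simp
    qed
    then show ?thesis using mono[OF le] Lam(2) D(2) by (simp add: algebra_simps)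
  qed
qed

text \<open>
  Global solvability for a right-hand side that is globally Lipschitz in space, with a constant that may vary in
  time.  In the norm weighted by \<open>exp (2 \<bar>\<Lambda> t\<bar>)\<close>, with \<open>\<Lambda>\<close> an antiderivative of the Lipschitz constant, Picard's
  integral operator contracts by \<open>1/2\<close> on the entire line, so no gluing of local solutions is needed.
\<close>

theorem global_ode_solution:
  fixes f :: "real \<Rightarrow> 'a::euclidean_space \<Rightarrow> 'a"
  assumes cont: "continuous_on UNIV (\<lambda>(t, x). f t x)"
    and l: "continuous_on UNIV l"
    and lip: "\<And>t x y. norm (f t x - f t y) \<le> l t * norm (x - y)"
    and zero: "\<And>t. norm (f t 0) \<le> l t"
  obtains y where "y t0 = y0" "\<And>t. (y has_vector_derivative f t (y t)) (at t)"
proof -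
  have lnn: "l t \<ge> 0" for t using zero[of t] norm_ge_zero order_trans by blast
  obtain \<Lambda> where "\<And>t. (\<Lambda> has_vector_derivative l t) (at t)" and Lam0: "\<Lambda> t0 = 0"
    using antiderivative_exists[OF l, of t0 0] by blast
  then have Lam: "\<And>t. (\<Lambda> has_real_derivative l t) (at t)"
    by (simp add: has_real_derivative_iff_has_vector_derivative)
  have contLam: "continuous_on UNIV \<Lambda>"
    by (rule DERIV_continuous_on) (use Lam in \<open>auto intro: DERIV_subset\<close>)
  define w where "w t = exp (2 * \<bar>\<Lambda> t\<bar>)" for t
  have contw: "continuous_on UNIV w"
    unfolding w_def by (intro continuous_intros contLam)
  have w1: "w t \<ge> 1" for t by (simp add: w_def)
  define g where "g u s = f s (w s *\<^sub>R apply_bcontfun u s)" for u s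
  have contg: "continuous_on UNIV (g u)" for u
    unfolding g_def
    by (rule continuous_on_compose2[OF cont, of UNIV "\<lambda>s. (s, w s *\<^sub>R apply_bcontfun u s)", simplified])
      (intro continuous_intros contw continuous_on_apply_bcontfun)
  have "\<exists>Q. (\<forall>t. (Q has_vector_derivative g u t) (at t)) \<and> Q t0 = y0" for u
    using antiderivative_exists[OF contg] by metis
  then obtain Q where Q: "\<And>u t. (Q u has_vector_derivative g u t) (at t)" "\<And>u. Q u t0 = y0"
    by metis
  have diff: "norm (Q u t - Q v t) \<le> dist u v / 2 * (w t - 1)" for u v t
    unfolding w_def
  proof (rule exponential_weight_comparison[OF Lam Lam0 lnn, of "\<lambda>t. Q u t - Q v t" "\<lambda>t. g u t - g v t"])
    show "norm (g u t - g v t) \<le> dist u v * (l t * exp (2 * \<bar>\<Lambda> t\<bar>))" for t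
    proof -
      have "norm (g u t - g v t) \<le> l t * norm (w t *\<^sub>R apply_bcontfun u t - w t *\<^sub>R apply_bcontfun v t)"
        unfolding g_def by (rule lip)
      also have "\<dots> = l t * (w t * norm (apply_bcontfun u t - apply_bcontfun v t))"
        using w1[of t] by (simp flip: scaleR_diff_right)
      also have "\<dots> \<le> l t * (w t * dist u v)"
        using w1[of t] lnn[of t] by (intro mult_left_mono bcontfun_dist_val) auto
      finally show ?thesis by (simp add: w_def mult_ac)
    qed
  qed (auto intro!: derivative_eq_intros Q simp: Q)
  have grow: "norm (Q u t - y0) \<le> (1 + norm u) / 2 * (w t - 1)" for u t
    unfolding w_def
  proof (rule exponential_weight_comparison[OF Lam Lam0 lnn, of "\<lambda>t. Q u t - y0" "g u"])
    show "norm (g u t) \<le> (1 + norm u) * (l t * exp (2 * \<bar>\<Lambda> t\<bar>))" for t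
    proof -
      have "norm (g u t) \<le> norm (f t 0) + norm (g u t - f t 0)"
        using norm_triangle_ineq[of "f t 0" "g u t - f t 0"] by simp
      also have "\<dots> \<le> l t + l t * (w t * norm (apply_bcontfun u t))"
        using zero[of t] lip[of t "w t *\<^sub>R apply_bcontfun u t" 0] w1[of t] by (simp add: g_def)
      also have "\<dots> \<le> l t * w t + l t * (w t * norm u)"
        using w1[of t] lnn[of t] by (intro add_mono mult_left_mono norm_bounded) (auto simp: mult_le_cancel_left1)
      finally show ?thesis by (simp add: w_def algebra_simps)
    qed
  qed (auto intro!: derivative_eq_intros Q simp: Q)
  define \<Phi> where "\<Phi> u = Bcontfun (\<lambda>t. Q u t /\<^sub>R w t)" for u
  have Phi: "apply_bcontfun (\<Phi> u) t = Q u t /\<^sub>R w t" for u t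
  proof -
    have "(\<lambda>t. Q u t /\<^sub>R w t) \<in> bcontfun"
    proof (rule bcontfun_normI)
      have "continuous_on UNIV (Q u)"
        by (rule has_vector_derivative_imp_continuous_on) (rule Q)
      then show "continuous_on UNIV (\<lambda>t. Q u t /\<^sub>R w t)"
        using w1 by (intro continuous_intros contw) (metis not_one_le_zero)
      fix t
      have "norm (Q u t) \<le> norm y0 + norm (Q u t - y0)"
        using norm_triangle_ineq[of y0 "Q u t - y0"] by simp
      also have "\<dots> \<le> norm y0 * w t + (1 + norm u) / 2 * w t"
        using grow[of u t] mult_left_mono[OF w1[of t], of "norm y0"]
          mult_left_mono[of "w t - 1" "w t" "(1 + norm u) / 2"] by simp
      finally show "norm (Q u t /\<^sub>R w t) \<le> norm y0 + (1 + norm u) / 2"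
        using w1[of t] by (simp add: divide_simps algebra_simps)
    qed
    then show ?thesis unfolding \<Phi>_def by (simp add: Bcontfun_inverse)
  qed
  have "dist (\<Phi> u) (\<Phi> v) \<le> 1/2 * dist u v" for u v
  proof (rule dist_bound)
    fix t
    have "dist (apply_bcontfun (\<Phi> u) t) (apply_bcontfun (\<Phi> v) t) = norm (Q u t - Q v t) / w t"
      using w1[of t] by (simp add: Phi dist_norm divide_inverse flip: scaleR_diff_right)
    also have "\<dots> \<le> dist u v / 2 * w t / w t"
      using diff[of u t v] w1[of t] mult_left_mono[of "w t - 1" "w t" "dist u v / 2"]
      by (intro divide_right_mono) auto
    also have "\<dots> = 1/2 * dist u v" using w1[of t] by simp
    finally show "dist (apply_bcontfun (\<Phi> u) t) (apply_bcontfun (\<Phi> v) t) \<le> 1/2 * dist u v" .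
  qed
  then obtain u where u: "\<Phi> u = u"
    using banach_fix_type[of "1/2" \<Phi>] by auto
  have eq: "Q u t = w t *\<^sub>R apply_bcontfun u t" for t
    using Phi[of u t] w1[of t] by (simp add: u)
  show ?thesis
  proof
    show "Q u t0 = y0" by (rule Q)
    show "(Q u has_vector_derivative f t (Q u t)) (at t)" for t
      using Q(1)[of u t] by (simp add: g_def eq)
  qed
qed

text \<open>
  The second-order problem with zero data at infinity.  The fixed-point operator maps \<open>b\<close> to the double
  antiderivative of \<open>G t (b t)\<close> that vanishes at infinity together with its derivative.  Since bounded functions on
  the whole line form the complete space used here, everything is frozen at its value at \<open>T\<close> for \<open>t < T\<close>.
\<close>

theorem terminal_value_solution:
  fixes G :: "real \<Rightarrow> 'a::euclidean_space \<Rightarrow> 'a"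
  assumes "T > 0" "p > 2" "q > 2"
    and cont: "continuous_on ({T..} \<times> UNIV) (\<lambda>(t, x). G t x)"
    and bound: "\<And>t x. t \<ge> T \<Longrightarrow> norm (G t x) \<le> M * t powr (- p)"
    and lip: "\<And>t x y. t \<ge> T \<Longrightarrow> norm (G t x - G t y) \<le> L * t powr (- q) * norm (x - y)"
    and "L \<ge> 0" and small: "L / ((q - 1) * (q - 2)) * T powr (2 - q) \<le> 1/2"
  obtains B B' where
    "\<And>t. t > T \<Longrightarrow> (B has_vector_derivative B' t) (at t)"
    "\<And>t. t > T \<Longrightarrow> (B' has_vector_derivative G t (B t)) (at t)"
    "\<And>t. t > T \<Longrightarrow> norm (B t) \<le> M / ((p - 1) * (p - 2)) * t powr (2 - p)"
proof -
  define g where "g b s = G (max T s) (apply_bcontfun b s)" for b s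
  have contg: "continuous_on UNIV (g b)" for b
    unfolding g_def
    by (rule continuous_on_compose2[OF cont, of UNIV "\<lambda>s. (max T s, apply_bcontfun b s)", simplified])
      (auto intro!: continuous_intros continuous_on_apply_bcontfun)
  have boundg: "norm (g b t) \<le> M * t powr (- p)" if "t \<ge> T" for b t
    using bound[of t] that by (simp add: g_def)
  have "\<exists>Q1 Q2. (\<forall>t. (Q1 has_vector_derivative g b t) (at t)) \<and> (Q1 \<longlongrightarrow> 0) at_top \<and>
    (\<forall>t. (Q2 has_vector_derivative Q1 t) (at t)) \<and> (Q2 \<longlongrightarrow> 0) at_top" for b
  proof -
    obtain Q1 where Q1: "\<And>t. (Q1 has_vector_derivative g b t) (at t)" "(Q1 \<longlongrightarrow> 0) at_top"
      using antiderivative_vanishing_at_infinity[OF contg \<open>T > 0\<close>, of p b M] boundg \<open>p > 2\<close> by auto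
    have "norm (Q1 t) \<le> M / (p - 1) * t powr (- (p - 1))" if "t \<ge> T" for t
      using tail_bound_power_decay[of T p Q1 0 "g b" M t] Q1 boundg that \<open>T > 0\<close> \<open>p > 2\<close> by simp
    moreover have "continuous_on UNIV Q1"
      by (rule has_vector_derivative_imp_continuous_on) (rule Q1)
    ultimately obtain Q2 where "\<And>t. (Q2 has_vector_derivative Q1 t) (at t)" "(Q2 \<longlongrightarrow> 0) at_top"
      using antiderivative_vanishing_at_infinity[of Q1 T "p - 1" "M / (p - 1)"] \<open>T > 0\<close> \<open>p > 2\<close> by auto
    then show ?thesis using Q1 by blast
  qed
  then obtain Q1 Q2 where
    Q1: "\<And>b t. (Q1 b has_vector_derivative g b t) (at t)" "\<And>b. (Q1 b \<longlongrightarrow> 0) at_top" and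
    Q2: "\<And>b t. (Q2 b has_vector_derivative Q1 b t) (at t)" "\<And>b. (Q2 b \<longlongrightarrow> 0) at_top"
    by metis
  have grow: "norm (Q2 b t) \<le> M / ((p - 1) * (p - 2)) * t powr (2 - p)" if "t \<ge> T" for b t
    by (rule double_tail_bound[OF \<open>T > 0\<close> \<open>p > 2\<close> Q1(2) Q2(2) Q2(1) Q1(1) boundg that])
  have diff: "norm (Q2 b t - Q2 c t) \<le> 1/2 * dist b c" if "t \<ge> T" for b c t
  proof -
    have "norm (Q2 b t - Q2 c t) \<le> (L * dist b c) / ((q - 1) * (q - 2)) * t powr (2 - q)"
    proof (rule double_tail_bound[OF \<open>T > 0\<close> \<open>q > 2\<close> _ _ _ _ _ that])
      show "((\<lambda>t. Q1 b t - Q1 c t) \<longlongrightarrow> 0) at_top" "((\<lambda>t. Q2 b t - Q2 c t) \<longlongrightarrow> 0) at_top"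
        using tendsto_diff[OF Q1(2)[of b] Q1(2)[of c]] tendsto_diff[OF Q2(2)[of b] Q2(2)[of c]] by simp_all
      show "((\<lambda>t. Q2 b t - Q2 c t) has_vector_derivative Q1 b t - Q1 c t) (at t)" for t
        by (intro has_vector_derivative_diff Q2)
      show "((\<lambda>t. Q1 b t - Q1 c t) has_vector_derivative g b t - g c t) (at t)" for t
        by (intro has_vector_derivative_diff Q1)
      fix t assume "t \<ge> T"
      then have "norm (g b t - g c t) \<le> L * t powr (- q) * norm (apply_bcontfun b t - apply_bcontfun c t)"
        using lip[of t] by (simp add: g_def)
      also have "\<dots> \<le> L * t powr (- q) * dist b c"
        using \<open>L \<ge> 0\<close> by (intro mult_left_mono bcontfun_dist_val) auto
      finally show "norm (g b t - g c t) \<le> L * dist b c * t powr (- q)" by (simp add: mult_ac)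
    qed
    also have "\<dots> \<le> (L * dist b c) / ((q - 1) * (q - 2)) * T powr (2 - q)"
      using \<open>L \<ge> 0\<close> \<open>q > 2\<close> \<open>T > 0\<close> that
      by (intro mult_left_mono powr_mono2') auto
    also have "\<dots> = dist b c * (L / ((q - 1) * (q - 2)) * T powr (2 - q))" by simp
    also have "\<dots> \<le> dist b c * (1/2)"
      by (intro mult_left_mono small) auto
    finally show ?thesis by simp
  qed
  define \<Phi> where "\<Phi> b = Bcontfun (\<lambda>t. Q2 b (max T t))" for b
  have M: "M \<ge> 0"
    using bound[of T 0] \<open>T > 0\<close> norm_ge_zero[of "G T 0"]
    by (smt (verit) powr_gt_zero zero_le_mult_iff)
  have Phi: "apply_bcontfun (\<Phi> b) t = Q2 b (max T t)" for b t
  proof -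
    have "(\<lambda>t. Q2 b (max T t)) \<in> bcontfun"
    proof (rule bcontfun_normI)
      have "continuous_on UNIV (Q2 b)"
        by (rule has_vector_derivative_imp_continuous_on) (rule Q2)
      then show "continuous_on UNIV (\<lambda>t. Q2 b (max T t))"
        by (rule continuous_on_compose2) (auto intro!: continuous_intros)
      fix t
      have "norm (Q2 b (max T t)) \<le> M / ((p - 1) * (p - 2)) * (max T t) powr (2 - p)"
        by (rule grow) simp
      also have "\<dots> \<le> M / ((p - 1) * (p - 2)) * T powr (2 - p)"
        using M \<open>p > 2\<close> \<open>T > 0\<close> by (intro mult_left_mono powr_mono2') auto
      finally show "norm (Q2 b (max T t)) \<le> M / ((p - 1) * (p - 2)) * T powr (2 - p)" .
    qed
    then show ?thesis unfolding \<Phi>_def by (simp add: Bcontfun_inverse)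
  qed
  have "dist (\<Phi> b) (\<Phi> c) \<le> 1/2 * dist b c" for b c
    by (rule dist_bound) (use diff[of "max T _" b c] in \<open>simp add: Phi dist_norm\<close>)
  then obtain b where b: "\<Phi> b = b"
    using banach_fix_type[of "1/2" \<Phi>] by auto
  have eq: "apply_bcontfun b t = Q2 b t" if "t > T" for t
    using Phi[of b t] that by (simp add: b)
  show ?thesis
  proof
    fix t assume t: "t > T"
    show "(Q2 b has_vector_derivative Q1 b t) (at t)" by (rule Q2)
    show "(Q1 b has_vector_derivative G t (Q2 b t)) (at t)"
      using Q1(1)[of b t] eq[OF t] t by (simp add: g_def)
    show "norm (Q2 b t) \<le> M / ((p - 1) * (p - 2)) * t powr (2 - p)"
      using grow t by simp
  qed
qed

text \<open>
  A linear differential inequality whose coefficient, integrated twice from infinity, is finite has only the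
  trivial solution vanishing at infinity: every bound for \<open>D\<close> on a suitable half-line can be halved.
\<close>

lemma eventually_zero_of_integrable_lipschitz:
  fixes D :: "real \<Rightarrow> 'a::real_normed_vector"
  assumes "q > 2" "(D \<longlongrightarrow> 0) at_top"
    and "\<forall>\<^sub>F t in at_top. (D has_vector_derivative D' t) (at t)"
    and "\<forall>\<^sub>F t in at_top. (D' has_vector_derivative E t) (at t)"
    and "\<forall>\<^sub>F t in at_top. norm (E t) \<le> L * t powr (- q) * norm (D t)" and "L \<ge> 0"
  shows "\<forall>\<^sub>F t in at_top. D t = 0"
proof -
  have "((\<lambda>t. L / ((q - 1) * (q - 2)) * t powr (2 - q)) \<longlongrightarrow> 0) at_top"
    using \<open>q > 2\<close> by (intro powr_decay_at_top) auto
  then have "\<forall>\<^sub>F t in at_top. L / ((q - 1) * (q - 2)) * t powr (2 - q) < 1/2"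
    by (rule order_tendstoD) auto
  moreover have "\<forall>\<^sub>F t in at_top. norm (D t) < 1"
    using tendstoD[OF assms(2), of 1] by simp
  ultimately have "\<forall>\<^sub>F t in at_top. L / ((q - 1) * (q - 2)) * t powr (2 - q) < 1/2 \<and> norm (D t) < 1 \<and>
     (D has_vector_derivative D' t) (at t) \<and> (D' has_vector_derivative E t) (at t) \<and>
     norm (E t) \<le> L * t powr (- q) * norm (D t) \<and> t > 0"
    using assms(3-5) eventually_gt_at_top[of 0] by eventually_elim auto
  then obtain T where T: "\<And>t. t \<ge> T \<Longrightarrow> L / ((q - 1) * (q - 2)) * t powr (2 - q) < 1/2"
     "\<And>t. t \<ge> T \<Longrightarrow> norm (D t) < 1" "\<And>t. t \<ge> T \<Longrightarrow> (D has_vector_derivative D' t) (at t)"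
     "\<And>t. t \<ge> T \<Longrightarrow> (D' has_vector_derivative E t) (at t)"
     "\<And>t. t \<ge> T \<Longrightarrow> norm (E t) \<le> L * t powr (- q) * norm (D t)" "\<And>t. t \<ge> T \<Longrightarrow> t > 0"
    unfolding eventually_at_top_linorder by blast
  have Ele: "norm (E t) \<le> L * c * t powr (- q)" if "t \<ge> T" "norm (D t) \<le> c" for t c
  proof -
    have "norm (E t) \<le> L * t powr (- q) * norm (D t)" using T that by blast
    also have "\<dots> \<le> L * t powr (- q) * c" using that \<open>L \<ge> 0\<close> by (intro mult_left_mono) auto
    finally show ?thesis by (simp add: mult_ac)
  qed
  have "(E \<longlongrightarrow> 0) at_top"
  proof (rule Lim_null_comparison)
    show "\<forall>\<^sub>F t in at_top. norm (E t) \<le> L * 1 * t powr (- q)"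
      by (rule eventually_mono[OF eventually_ge_at_top[of T]]) (use Ele T(2) less_imp_le in blast)
    show "((\<lambda>t. L * 1 * t powr (- q)) \<longlongrightarrow> 0) at_top"
      using \<open>q > 2\<close> by (intro powr_decay_at_top) auto
  qed
  then have D'0: "(D' \<longlongrightarrow> 0) at_top"
    using derivative_vanishes_at_infinity[OF assms(2) _ T(3,4)] by blast
  have half: "norm (D t) \<le> c / 2" if "\<And>t. t \<ge> T \<Longrightarrow> norm (D t) \<le> c" "t \<ge> T" for c t
  proof -
    have "norm (D t) \<le> L * c / ((q - 1) * (q - 2)) * t powr (2 - q)"
      by (rule double_tail_bound[OF T(6)[OF order_refl] \<open>q > 2\<close> D'0 assms(2) T(3,4) Ele])
        (use that in auto)
    also have "\<dots> = c * (L / ((q - 1) * (q - 2)) * t powr (2 - q))" by simp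
    also have "\<dots> \<le> c * (1/2)"
    proof (intro mult_left_mono)
      show "0 \<le> c" using that norm_ge_zero[of "D t"] by (meson order_trans)
    qed (use T(1)[OF that(2)] in simp)
    finally show ?thesis by simp
  qed
  have pow: "norm (D t) \<le> (1/2) ^ n" if "t \<ge> T" for t n
    using that
  proof (induction n arbitrary: t)
    case 0 then show ?case using T(2)[of t] by simp
  next
    case (Suc n) then show ?case using half[of "(1/2) ^ n" t] by simp
  qed
  have "norm (D t) \<le> 0" if "t \<ge> T" for t
    by (rule LIMSEQ_le_const[OF LIMSEQ_power_zero[of "1/2 :: real"]]) (use pow[OF that] in auto)
  then show ?thesis unfolding eventually_at_top_linorder by auto
qed

text \<open>
  The function \<open>N t exp (- K t)\<close> is nonincreasing.
\<close>

lemma gronwall_zero_forward: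
  fixes N :: "real \<Rightarrow> real"
  assumes "a \<le> b" "\<And>t. a \<le> t \<Longrightarrow> t \<le> b \<Longrightarrow> (N has_real_derivative N' t) (at t)"
    and "\<And>t. a \<le> t \<Longrightarrow> t \<le> b \<Longrightarrow> N' t \<le> K * N t" "N a = 0"
  shows "N b \<le> 0"
proof -
  have "(\<lambda>t. N t * exp (- K * t)) b \<le> (\<lambda>t. N t * exp (- K * t)) a"
  proof (rule DERIV_nonpos_imp_nonincreasing[OF \<open>a \<le> b\<close>], intro exI conjI)
    fix x assume x: "a \<le> x" "x \<le> b"
    show "((\<lambda>t. N t * exp (- K * t)) has_real_derivative (N' x - K * N x) * exp (- K * x)) (at x)"
      by (auto intro!: derivative_eq_intros assms x simp: algebra_simps)
    show "(N' x - K * N x) * exp (- K * x) \<le> 0"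
      using assms(3)[OF x] by (simp add: mult_le_0_iff)
  qed
  then show ?thesis using \<open>N a = 0\<close> by (simp add: mult_le_0_iff)
qed

lemma gronwall_zero_backward:
  fixes N :: "real \<Rightarrow> real"
  assumes "a \<le> b" "\<And>t. a \<le> t \<Longrightarrow> t \<le> b \<Longrightarrow> (N has_real_derivative N' t) (at t)"
    and "\<And>t. a \<le> t \<Longrightarrow> t \<le> b \<Longrightarrow> - N' t \<le> K * N t" "N b = 0"
  shows "N a \<le> 0"
proof -
  have "(\<lambda>t. N (- t)) (- a) \<le> 0"
  proof (rule gronwall_zero_forward[of "- b" "- a" _ "\<lambda>t. - N' (- t)" K])
    fix t assume "- b \<le> t" "t \<le> - a"
    then have "(N has_real_derivative N' (- t)) (at (- t))" by (intro assms(2)) auto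
    then show "((\<lambda>t. N (- t)) has_real_derivative - N' (- t)) (at t)"
      by (simp add: DERIV_mirror)
  qed (use assms(1,4) assms(3)[of "- _"] in auto)
  then show ?thesis by simp
qed

section \<open>Cofactor matrices and the force field\<close>

text \<open>
  The symmetric bilinear map whose diagonal is the quadratic map \<open>cof\<close>.  Working with it reduces the derivatives and
  Lipschitz estimates of the cofactor matrix and the determinant to bilinear algebra.
\<close>

definition polar_cof :: "real^3^3 \<Rightarrow> real^3^3 \<Rightarrow> real^3^3" where
  "polar_cof X Y = (1/2) *\<^sub>R vector
     [cross3 (X$2) (Y$3) + cross3 (Y$2) (X$3),
      cross3 (X$3) (Y$1) + cross3 (Y$3) (X$1),
      cross3 (X$1) (Y$2) + cross3 (Y$1) (X$2)]"

definition cof :: "real^3^3 \<Rightarrow> real^3^3" where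
  "cof X = polar_cof X X"

lemma bilinear_polar_cof: "bilinear polar_cof"
  unfolding bilinear_def linear_iff by
    (simp_all add: polar_cof_def vec_eq_iff forall_3 vector_3 cross3_def algebra_simps)


lemma polar_cof_commute: "polar_cof X Y = polar_cof Y X"
  by (simp add: polar_cof_def add.commute)

text \<open>
  The trilinear form \<open>polar_cof X Y \<bullet> Z\<close> is totally symmetric: it is the polarisation of the determinant, up to
  the factor \<open>3\<close>.
\<close>

lemma polar_cof_inner_swap: "polar_cof X Y \<bullet> Z = polar_cof X Z \<bullet> Y"
  unfolding polar_cof_def inner_scaleR_left
  by (rule arg_cong[where f = "\<lambda>x. 1/2 * x"])
    (simp add: inner_vec_def sum_3 vector_3 cross3_def algebra_simps)

lemma polar_cof_inner_cases:
  "polar_cof X Y \<bullet> X = polar_cof X X \<bullet> Y" "polar_cof X Y \<bullet> Y = polar_cof Y Y \<bullet> X"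
  by (metis polar_cof_commute polar_cof_inner_swap)+

lemma cof_eq_cross3:
  "cof X = vector [cross3 (X$2) (X$3), cross3 (X$3) (X$1), cross3 (X$1) (X$2)]"
  by (simp add: cof_def polar_cof_def vec_eq_iff forall_3 vector_3)

lemma det_eq_cof_inner:
  fixes X :: "real^3^3"
  shows "det X = (cof X \<bullet> X) / 3"
proof -
  have "cof X \<bullet> X = 3 * det X"
    by (simp add: cof_eq_cross3 inner_vec_def sum_3 vector_3 cross3_def det_3 algebra_simps)
  then show ?thesis by simp
qed

text \<open>
  This is the adjugate identity \<open>X (cof X)\<^sup>T = (det X) I\<close>, multiplied by the inverse of \<open>X\<close>.
\<close>

lemma cof_eq_det_inverse_transpose:
  assumes "det X \<noteq> 0"
  shows "cof X = det X *\<^sub>R inverse_transpose X"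
proof -
  have "X ** transpose (cof X) = det X *\<^sub>R mat 1"
    by (simp add: cof_eq_cross3 vec_eq_iff forall_3 matrix_matrix_mult_def transpose_def
        mat_def sum_3 vector_3 cross3_def det_3 algebra_simps)
  then have "matrix_inv X ** (X ** transpose (cof X)) = matrix_inv X ** (det X *\<^sub>R mat 1)"
    by simp
  moreover have "matrix_inv X ** X = mat 1"
    using assms someI_ex[of "\<lambda>B. X ** B = mat 1 \<and> B ** X = mat 1"]
    unfolding matrix_inv_def by (simp add: invertible_det_nz[symmetric] invertible_def)
  ultimately have "transpose (cof X) = det X *\<^sub>R matrix_inv X"
    by (simp add: matrix_mul_assoc matrix_scalar_ac)
  then have "transpose (transpose (cof X)) = det X *\<^sub>R transpose (matrix_inv X)"
    by (simp add: transpose_scalar)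
  then show ?thesis by (simp add: inverse_transpose_def)
qed

lemma norm_polar_cof_le: "norm (polar_cof X Y) \<le> 3 * norm X * norm Y"
proof -
  have row: "norm ((1/2) *\<^sub>R (cross3 (X$i) (Y$j) + cross3 (Y$i) (X$j))) \<le> norm X * norm Y" for i j
  proof -
    have "norm (cross3 (U$k) (V$l)) \<le> norm U * norm V" for U V :: "real^3^3" and k l
    proof -
      have "norm (cross3 (U$k) (V$l)) \<le> norm (U$k) * norm (V$l)"
        by (rule power2_le_imp_le) (simp_all add: norm_cross power_mult_distrib)
      also have "\<dots> \<le> norm U * norm V"
        by (intro mult_mono Finite_Cartesian_Product.norm_nth_le) auto
      finally show ?thesis .
    qed
    from this[of X i Y j] this[of Y i X j] show ?thesis
      using norm_triangle_ineq[of "cross3 (X$i) (Y$j)" "cross3 (Y$i) (X$j)"] by (simp add: mult.commute)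
  qed
  have "norm (polar_cof X Y) \<le> (\<Sum>i\<in>UNIV. norm (polar_cof X Y $ i))"
    unfolding norm_vec_def[of "polar_cof X Y"] by (rule L2_set_le_sum) simp
  also have "\<dots> \<le> norm X * norm Y + norm X * norm Y + norm X * norm Y"
    unfolding sum_3 using row[of 2 3] row[of 3 1] row[of 1 2]
    by (intro add_mono) (simp_all add: polar_cof_def vector_3)
  finally show ?thesis by simp
qed

lemma bounded_bilinear_polar_cof: "bounded_bilinear polar_cof"
  using bilinear_polar_cof by (simp add: bilinear_conv_bounded_bilinear)

interpretation polar_cof: bounded_bilinear polar_cof
  by (rule bounded_bilinear_polar_cof)

lemma norm_cof_le:
  assumes "norm X \<le> R"
  shows "norm (cof X) \<le> 3 * R\<^sup>2"
proof -
  have "norm (cof X) \<le> 3 * (norm X)\<^sup>2"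
    using norm_polar_cof_le[of X X] by (simp add: cof_def power2_eq_square mult_ac)
  also have "\<dots> \<le> 3 * R\<^sup>2" using assms by (simp add: power_mono)
  finally show ?thesis .
qed

lemma norm_cof_diff_le:
  assumes "norm X \<le> R" "norm Y \<le> R"
  shows "norm (cof X - cof Y) \<le> 6 * R * norm (X - Y)"
proof -
  have "cof X - cof Y = polar_cof (X - Y) (X + Y)"
    unfolding cof_def by (simp add: polar_cof.add_right polar_cof.diff_left polar_cof_commute[of Y X])
  also have "norm \<dots> \<le> 3 * norm (X - Y) * norm (X + Y)" by (rule norm_polar_cof_le)
  also have "\<dots> \<le> 3 * norm (X - Y) * (2 * R)"
    using norm_triangle_ineq[of X Y] assms by (intro mult_left_mono) auto
  finally show ?thesis by (simp add: mult_ac)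
qed

text \<open>
  A difference of cubes: by total symmetry, \<open>3 (det X - det Y)\<close> is the pairing of \<open>X - Y\<close> with
  \<open>cof X + polar_cof X Y + cof Y\<close>.
\<close>

lemma det_diff_le:
  fixes X Y :: "real^3^3"
  assumes "norm X \<le> R" "norm Y \<le> R"
  shows "\<bar>det X - det Y\<bar> \<le> 3 * R\<^sup>2 * norm (X - Y)"
proof -
  have "3 * (det X - det Y) = (cof X + polar_cof X Y + cof Y) \<bullet> (X - Y)"
    unfolding det_eq_cof_inner cof_def
    by (simp add: inner_add_left inner_diff_right polar_cof_inner_cases[of X Y])
  then have "3 * \<bar>det X - det Y\<bar> = \<bar>(cof X + polar_cof X Y + cof Y) \<bullet> (X - Y)\<bar>"
    by (metis abs_mult abs_numeral)
  also have "\<dots> \<le> norm (cof X + polar_cof X Y + cof Y) * norm (X - Y)"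
    by (rule Cauchy_Schwarz_ineq2)
  also have "\<dots> \<le> (9 * R\<^sup>2) * norm (X - Y)"
  proof (rule mult_right_mono)
    have "norm (polar_cof X Y) \<le> 3 * R * R"
      using norm_polar_cof_le[of X Y] assms mult_mono[of "norm X" R "norm Y" R]
        order_trans[OF norm_ge_zero assms(1)] by simp
    then show "norm (cof X + polar_cof X Y + cof Y) \<le> 9 * R\<^sup>2"
      using norm_triangle_ineq[of "cof X + polar_cof X Y" "cof Y"] norm_triangle_ineq[of "cof X" "polar_cof X Y"]
        norm_cof_le[OF assms(1)] norm_cof_le[OF assms(2)] by (simp add: power2_eq_square)
  qed simp
  finally show ?thesis by (simp add: mult_ac)
qed

lemma det_add:
  fixes X Y :: "real^3^3"
  shows "det (X + Y) = det X + cof X \<bullet> Y + cof Y \<bullet> X + det Y"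
  unfolding det_eq_cof_inner cof_def
  by (simp add: polar_cof.add_left polar_cof.add_right inner_add_left inner_add_right
      polar_cof_inner_cases[of X Y] polar_cof_inner_cases[of Y X] field_simps)

lemma cof_scaleR: "cof (c *\<^sub>R X) = c\<^sup>2 *\<^sub>R cof X"
  by (simp add: cof_def polar_cof.scaleR_left polar_cof.scaleR_right power2_eq_square)

lemma cof_add: "cof (X + Y) = cof X + 2 *\<^sub>R polar_cof X Y + cof Y"
  by (simp add: cof_def polar_cof.add_left polar_cof.add_right polar_cof_commute[of Y X] scaleR_2)

lemma det_affine:
  fixes A0 A1 :: "real^3^3"
  shows "det (A0 + t *\<^sub>R A1) = det A0 + (cof A0 \<bullet> A1) * t + (cof A1 \<bullet> A0) * t^2 + det A1 * t^3"
proof -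
  have "det (t *\<^sub>R A1) = t^3 * det A1"
    by (simp add: det_eq_cof_inner cof_scaleR power3_eq_cube power2_eq_square mult_ac)
  then show ?thesis by (simp add: det_add cof_scaleR)
qed

lemma has_vector_derivative_cof:
  assumes "(A has_vector_derivative A') (at t within S)"
  shows "((\<lambda>t. cof (A t)) has_vector_derivative 2 *\<^sub>R polar_cof (A t) A') (at t within S)"
  unfolding cof_def
  using bounded_bilinear.has_vector_derivative[OF bounded_bilinear_polar_cof assms assms]
  by (simp add: polar_cof_commute[of A'] scaleR_2)

text \<open>
  Jacobi's formula: the gradient of the determinant is the cofactor matrix.
\<close>

lemma has_real_derivative_det:
  assumes "(A has_vector_derivative A') (at t within S)"
  shows "((\<lambda>t. det (A t)) has_real_derivative cof (A t) \<bullet> A') (at t within S)"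
proof -
  have "((\<lambda>t. (cof (A t) \<bullet> A t) * (1/3)) has_vector_derivative
      (cof (A t) \<bullet> A' + (2 *\<^sub>R polar_cof (A t) A') \<bullet> A t) * (1/3)) (at t within S)"
    by (intro has_vector_derivative_mult_left bounded_bilinear.has_vector_derivative[OF bounded_bilinear_inner]
        has_vector_derivative_cof assms)
  moreover have "polar_cof (A t) A' \<bullet> A t = cof (A t) \<bullet> A'"
    unfolding cof_def by (rule polar_cof_inner_swap)
  ultimately show ?thesis
    by (simp add: has_real_derivative_iff_has_vector_derivative det_eq_cof_inner)
qed

lemma continuous_on_cof [continuous_intros]:
  "continuous_on S f \<Longrightarrow> continuous_on S (\<lambda>x. cof (f x))"
  unfolding cof_def by (rule polar_cof.continuous_on)

lemma continuous_on_det3 [continuous_intros]: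
  fixes f :: "'a::topological_space \<Rightarrow> real^3^3"
  shows "continuous_on S f \<Longrightarrow> continuous_on S (\<lambda>x. det (f x))"
  unfolding det_eq_cof_inner by (intro continuous_intros) auto

definition force :: "real \<Rightarrow> real^3^3 \<Rightarrow> real^3^3" where
  "force \<gamma> X = det X powr (- \<gamma>) *\<^sub>R cof X"

lemma force_eq_inverse_transpose:
  assumes "det X > 0"
  shows "force \<gamma> X = det X powr (1 - \<gamma>) *\<^sub>R inverse_transpose X"
  using assms cof_eq_det_inverse_transpose[of X] powr_add[of "det X" "- \<gamma>" 1]
  by (simp add: force_def)

text \<open>
  Bounding the determinant from below by \<open>\<delta> > 0\<close> removes the singularity of the force and makes it locally Lipschitz on
  all matrices, so that estimates need no path between \<open>X\<close> and \<open>Y\<close> inside the set of positive determinant.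
\<close>

definition regular_force :: "real \<Rightarrow> real \<Rightarrow> real^3^3 \<Rightarrow> real^3^3" where
  "regular_force \<gamma> \<delta> X = (max \<delta> (det X)) powr (- \<gamma>) *\<^sub>R cof X"

lemma regular_force_eq: "det X \<ge> \<delta> \<Longrightarrow> regular_force \<gamma> \<delta> X = force \<gamma> X"
  by (simp add: regular_force_def force_def max_def)

lemma regular_force_bound:
  assumes "\<delta> > 0" "\<gamma> \<ge> 0" "norm X \<le> R"
  shows "norm (regular_force \<gamma> \<delta> X) \<le> 3 * \<delta> powr (- \<gamma>) * R\<^sup>2"
proof -
  have "norm (regular_force \<gamma> \<delta> X) \<le> \<delta> powr (- \<gamma>) * (3 * R\<^sup>2)"
    unfolding regular_force_def norm_scaleR
    by (rule mult_mono) (use assms norm_cof_le powr_mono2' in auto)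
  then show ?thesis by simp
qed

lemma powr_neg_lipschitz:
  fixes a b :: real
  assumes "\<delta> > 0" "\<gamma> \<ge> 0" "a \<ge> \<delta>" "b \<ge> \<delta>"
  shows "\<bar>a powr (- \<gamma>) - b powr (- \<gamma>)\<bar> \<le> \<gamma> * \<delta> powr (- \<gamma> - 1) * \<bar>a - b\<bar>"
proof -
  have "norm (a powr (- \<gamma>) - b powr (- \<gamma>)) \<le> (\<gamma> * \<delta> powr (- \<gamma> - 1)) * norm (a - b)"
  proof (rule field_differentiable_bound[of "{\<delta>..}"])
    fix z assume "z \<in> {\<delta>..}"
    then have z: "z \<ge> \<delta>" "z > 0" using \<open>\<delta> > 0\<close> by auto
    show "((\<lambda>z. z powr (- \<gamma>)) has_field_derivative (- \<gamma>) * z powr (- \<gamma> - 1)) (at z within {\<delta>..})"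
      by (rule has_field_derivative_at_within) (rule has_real_derivative_powr[OF z(2)])
    show "norm ((- \<gamma>) * z powr (- \<gamma> - 1)) \<le> \<gamma> * \<delta> powr (- \<gamma> - 1)"
      using assms z powr_mono2'[of "- \<gamma> - 1" \<delta> z] by (simp add: abs_mult mult_left_mono)
  qed (use assms in auto)
  then show ?thesis by simp
qed

lemma regular_force_lipschitz:
  assumes "\<delta> > 0" "\<gamma> \<ge> 0" "norm X \<le> R" "norm Y \<le> R"
  shows "norm (regular_force \<gamma> \<delta> X - regular_force \<gamma> \<delta> Y)
    \<le> (9 * \<gamma> * \<delta> powr (- \<gamma> - 1) * R^4 + 6 * \<delta> powr (- \<gamma>) * R) * norm (X - Y)"
proof -
  have "R \<ge> 0" using assms(3) norm_ge_zero order_trans by blast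
  let ?x = "max \<delta> (det X)" and ?y = "max \<delta> (det Y)"
  have "\<bar>?x powr (- \<gamma>) - ?y powr (- \<gamma>)\<bar> \<le> \<gamma> * \<delta> powr (- \<gamma> - 1) * \<bar>?x - ?y\<bar>"
    using assms by (intro powr_neg_lipschitz) auto
  also have "\<dots> \<le> \<gamma> * \<delta> powr (- \<gamma> - 1) * (3 * R\<^sup>2 * norm (X - Y))"
    using assms det_diff_le[OF assms(3,4)] by (intro mult_left_mono) auto
  finally have 1: "\<bar>?x powr (- \<gamma>) - ?y powr (- \<gamma>)\<bar> \<le> \<gamma> * \<delta> powr (- \<gamma> - 1) * (3 * R\<^sup>2 * norm (X - Y))" .
  have "regular_force \<gamma> \<delta> X - regular_force \<gamma> \<delta> Y =
      (?x powr (- \<gamma>) - ?y powr (- \<gamma>)) *\<^sub>R cof X + ?y powr (- \<gamma>) *\<^sub>R (cof X - cof Y)"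
    by (simp add: regular_force_def algebra_simps)
  also have "norm \<dots> \<le> \<bar>?x powr (- \<gamma>) - ?y powr (- \<gamma>)\<bar> * norm (cof X) + ?y powr (- \<gamma>) * norm (cof X - cof Y)"
    by (rule norm_triangle_le) simp
  also have "\<dots> \<le> \<gamma> * \<delta> powr (- \<gamma> - 1) * (3 * R\<^sup>2 * norm (X - Y)) * (3 * R\<^sup>2)
      + \<delta> powr (- \<gamma>) * (6 * R * norm (X - Y))"
    using assms \<open>R \<ge> 0\<close>
    by (intro add_mono mult_mono 1 norm_cof_le norm_cof_diff_le powr_mono2') auto
  also have "\<dots> = (9 * \<gamma> * \<delta> powr (- \<gamma> - 1) * R^4 + 6 * \<delta> powr (- \<gamma>) * R) * norm (X - Y)"
    by (simp add: algebra_simps power4_eq_xxxx power2_eq_square)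
  finally show ?thesis .
qed

text \<open>
  The nearest-point retraction onto the closed ball of radius \<open>r\<close>, in a form that is visibly continuous in \<open>r\<close>.
\<close>

definition trunc :: "real \<Rightarrow> 'a::real_normed_vector \<Rightarrow> 'a" where
  "trunc r x = (r / max r (norm x)) *\<^sub>R x"

lemma trunc_eq: "norm x \<le> r \<Longrightarrow> r > 0 \<Longrightarrow> trunc r x = x"
  by (simp add: trunc_def max_def)

lemma norm_trunc_le: "r > 0 \<Longrightarrow> norm (trunc r x) \<le> r"
  by (simp add: trunc_def max_def divide_simps)

lemma trunc_lipschitz:
  fixes x y :: "'a::euclidean_space"
  assumes "r > 0"
  shows "norm (trunc r x - trunc r y) \<le> norm (x - y)"
proof -
  have "trunc r x = closest_point (cball 0 r) x" for x :: 'a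
  proof (rule closest_point_unique)
    show "trunc r x \<in> cball 0 r" using norm_trunc_le[OF assms] by simp
    show "\<forall>z\<in>cball 0 r. dist x (trunc r x) \<le> dist x z"
    proof
      fix z :: 'a assume z: "z \<in> cball 0 r"
      show "dist x (trunc r x) \<le> dist x z"
      proof (cases "norm x \<le> r")
        case False
        have "x - trunc r x = (1 - r / norm x) *\<^sub>R x"
          using False by (simp add: trunc_def max_def algebra_simps)
        then have "dist x (trunc r x) = (1 - r / norm x) * norm x"
          using False assms by (simp add: dist_norm abs_if divide_simps)
        also have "\<dots> = norm x - r"
        proof -
          have "norm x \<noteq> 0" using False assms by linarith
          then show ?thesis by (simp add: left_diff_distrib)
        qed
        also have "\<dots> \<le> dist x z"
          using z norm_triangle_ineq2[of x z] by (simp add: dist_norm)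
        finally show ?thesis .
      qed (use assms in \<open>simp add: trunc_eq\<close>)
    qed
  qed auto
  then show ?thesis
    using closest_point_lipschitz[of "cball 0 r" x y] assms by (simp add: dist_norm)
qed

lemma continuous_on_trunc:
  assumes "continuous_on S r" "continuous_on S f" "\<And>x. x \<in> S \<Longrightarrow> r x > 0"
  shows "continuous_on S (\<lambda>x. trunc (r x) (f x))"
  unfolding trunc_def using assms(3)
  by (intro continuous_intros assms(1,2) ballI) (metis less_max_iff_disj less_irrefl)

text \<open>
  The leading nonzero coefficient must be positive and must not be the constant one.
\<close>

lemma cubic_at_top_lower_bound:
  fixes a b c d :: real
  assumes "filterlim (\<lambda>t. a + b * t + c * t^2 + d * t^3) at_top at_top"
  obtains k where "k > 0" "\<forall>\<^sub>F t in at_top. a + b * t + c * t^2 + d * t^3 \<ge> k * t"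
proof -
  have bot: False if "filterlim (\<lambda>t. a + b * t + c * t^2 + d * t^3) at_bot at_top"
    using filterlim_at_top_at_bot[OF assms that] by simp
  consider "d > 0" | "d < 0" | "d = 0" "c > 0" | "d = 0" "c < 0" | "d = 0" "c = 0" "b > 0"
    | "d = 0" "c = 0" "b < 0" | "d = 0" "c = 0" "b = 0" by linarith
  then show ?thesis
  proof cases
    case 1
    then have "\<forall>\<^sub>F t in at_top. a + b * t + c * t^2 + d * t^3 \<ge> 1 * t" by real_asymp
    then show ?thesis by (rule that[rotated]) simp
  next
    case 2
    then have "filterlim (\<lambda>t. a + b * t + c * t^2 + d * t^3) at_bot at_top" by real_asymp
    with bot show ?thesis by blast
  next
    case 3
    then have "\<forall>\<^sub>F t in at_top. a + b * t + c * t^2 \<ge> 1 * t" by real_asymp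
    then show ?thesis by (intro that[of 1]) (use 3 in simp_all)
  next
    case 4
    then have "filterlim (\<lambda>t. a + b * t + c * t^2) at_bot at_top" by real_asymp
    with bot 4 show ?thesis by simp
  next
    case 5
    then have "\<forall>\<^sub>F t in at_top. a + b * t \<ge> b / 2 * t" by real_asymp
    then show ?thesis by (intro that[of "b/2"]) (use 5 in simp_all)
  next
    case 6
    then have "filterlim (\<lambda>t. a + b * t) at_bot at_top" by real_asymp
    with bot 6 show ?thesis by simp
  next
    case 7
    then have "filterlim (\<lambda>t::real. a) at_top at_top" using assms by simp
    then show ?thesis
      using not_tendsto_and_filterlim_at_infinity[OF trivial_limit_at_top_linorder tendsto_const]
        filterlim_at_top_imp_at_infinity by blast
  qed
qed

section \<open>Energy and global solutions\<close>

definition solution_on :: "real \<Rightarrow> real set \<Rightarrow> (real \<Rightarrow> real^3^3) \<Rightarrow> (real \<Rightarrow> real^3^3) \<Rightarrow> bool" where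
  "solution_on \<gamma> S A V \<longleftrightarrow> (\<forall>t\<in>S. det (A t) > 0 \<and> (A has_vector_derivative V t) (at t) \<and>
     (V has_vector_derivative force \<gamma> (A t)) (at t))"

lemma solution_onD:
  assumes "solution_on \<gamma> S A V" "t \<in> S"
  shows "det (A t) > 0" "(A has_vector_derivative V t) (at t)"
    "(V has_vector_derivative force \<gamma> (A t)) (at t)"
  using assms by (auto simp: solution_on_def)

lemma solution_on_subset: "solution_on \<gamma> S A V \<Longrightarrow> T \<subseteq> S \<Longrightarrow> solution_on \<gamma> T A V"
  by (auto simp: solution_on_def)

definition energy :: "real \<Rightarrow> real^3^3 \<Rightarrow> real^3^3 \<Rightarrow> real" where
  "energy \<gamma> X W = (W \<bullet> W) / 2 + det X powr (1 - \<gamma>) / (\<gamma> - 1)"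

text \<open>
  By Jacobi's formula the derivative of the potential along the motion is \<open>- F A \<bullet> A'\<close>.
\<close>

lemma energy_conserved:
  assumes sol: "solution_on \<gamma> S A V" and "convex S" "s \<in> S" "t \<in> S" "\<gamma> > 1"
  shows "energy \<gamma> (A s) (V s) = energy \<gamma> (A t) (V t)"
proof -
  have "((\<lambda>t. energy \<gamma> (A t) (V t)) has_real_derivative 0) (at t within S)" if "t \<in> S" for t
  proof (rule has_field_derivative_at_within)
    note sol = solution_onD[OF sol that]
    have det: "((\<lambda>t. det (A t)) has_real_derivative cof (A t) \<bullet> V t) (at t)"
      by (rule has_real_derivative_det) (rule sol)
    have "((\<lambda>t. det (A t) powr (1 - \<gamma>)) has_real_derivative
        (1 - \<gamma>) * det (A t) powr (1 - \<gamma> - 1) * (cof (A t) \<bullet> V t)) (at t)"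
      using DERIV_chain2[OF has_real_derivative_powr[OF sol(1), of "1 - \<gamma>"] det] .
    moreover have "((\<lambda>t. V t \<bullet> V t) has_real_derivative
        V t \<bullet> force \<gamma> (A t) + force \<gamma> (A t) \<bullet> V t) (at t)"
      using bounded_bilinear.has_vector_derivative[OF bounded_bilinear_inner sol(3) sol(3)]
      by (simp add: has_real_derivative_iff_has_vector_derivative)
    ultimately have "((\<lambda>t. energy \<gamma> (A t) (V t)) has_real_derivative
        (V t \<bullet> force \<gamma> (A t) + force \<gamma> (A t) \<bullet> V t) / 2 +
        (1 - \<gamma>) * det (A t) powr (1 - \<gamma> - 1) * (cof (A t) \<bullet> V t) / (\<gamma> - 1)) (at t)"
      unfolding energy_def by (intro DERIV_add DERIV_cdivide)
    moreover have "(V t \<bullet> force \<gamma> (A t) + force \<gamma> (A t) \<bullet> V t) / 2 +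
        (1 - \<gamma>) * det (A t) powr (1 - \<gamma> - 1) * (cof (A t) \<bullet> V t) / (\<gamma> - 1) = 0"
    proof -
      have "(1 - \<gamma>) * x / (\<gamma> - 1) = - x" for x :: real
        using \<open>\<gamma> > 1\<close> by (simp add: divide_simps) (simp add: algebra_simps)
      from this[of "det (A t) powr (- \<gamma>) * (cof (A t) \<bullet> V t)"] show ?thesis
        by (simp add: force_def inner_commute mult_ac)
    qed
    ultimately show "((\<lambda>t. energy \<gamma> (A t) (V t)) has_real_derivative 0) (at t)" by simp
  qed
  then obtain c where "\<forall>x\<in>S. energy \<gamma> (A x) (V x) = c"
    using has_field_derivative_zero_constant[OF \<open>convex S\<close>] by blast
  then show ?thesis using assms by simp
qed

text \<open>
  Both summands of the energy are nonnegative, so each is at most \<open>E\<close>.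
\<close>

lemma energy_controls:
  assumes "\<gamma> > 1" "det X > 0" "energy \<gamma> X W \<le> E"
  shows "norm W \<le> sqrt (2 * E)" "det X \<ge> ((\<gamma> - 1) * E) powr (1 / (1 - \<gamma>))"
proof -
  have "(norm W)\<^sup>2 \<le> 2 * E"
  proof -
    have "det X powr (1 - \<gamma>) / (\<gamma> - 1) \<ge> 0" using \<open>\<gamma> > 1\<close> by simp
    then have "W \<bullet> W \<le> 2 * E" using assms(3) unfolding energy_def by linarith
    then show ?thesis by (simp add: power2_norm_eq_inner)
  qed
  then show "norm W \<le> sqrt (2 * E)" by (rule real_le_rsqrt)
  have "det X powr (1 - \<gamma>) / (\<gamma> - 1) \<le> E"
    using assms(3) inner_ge_zero[of W] unfolding energy_def by linarith
  then have "det X powr (1 - \<gamma>) \<le> (\<gamma> - 1) * E"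
    using \<open>\<gamma> > 1\<close> by (simp add: field_simps)
  then have "((\<gamma> - 1) * E) powr (1 / (1 - \<gamma>)) \<le> (det X powr (1 - \<gamma>)) powr (1 / (1 - \<gamma>))"
    using assms by (intro powr_mono2') auto
  also have "\<dots> = det X"
    using assms by (simp add: powr_powr)
  finally show "det X \<ge> ((\<gamma> - 1) * E) powr (1 / (1 - \<gamma>))" .
qed

text \<open>
  The force is cut off by a lower bound for the determinant and by a retraction onto balls whose radius grows
  faster than the energy lets the solution move.  The cut-off equation has a global solution.  At a time nearest to
  \<open>t0\<close> at which a cut-off becomes active, energy conservation up to that time would still give strict bounds; hence no
  such time exists.
\<close>

theorem global_solution:
  assumes "\<gamma> > 1" "det X0 > 0"
  obtains A V where "A t0 = X0" "V t0 = V0" "solution_on \<gamma> UNIV A V"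
proof -
  define E where "E = energy \<gamma> X0 V0"
  have "E > 0"
    using assms inner_ge_zero[of V0] by (simp add: E_def energy_def add_nonneg_pos)
  define d where "d = ((\<gamma> - 1) * E) powr (1 / (1 - \<gamma>))"
  \<comment> \<open>Every state of energy at most \<open>E\<close> has determinant at least \<open>d\<close>; halving makes the inequality strict.\<close>
  define \<delta> where "\<delta> = d / 2"
  have "d > 0" "\<delta> > 0" "\<delta> < d"
    using \<open>E > 0\<close> \<open>\<gamma> > 1\<close> by (simp_all add: d_def \<delta>_def)
  define v where "v = sqrt (2 * E)"
  have "v \<ge> 0" using \<open>E > 0\<close> by (simp add: v_def)
  \<comment> \<open>At speed at most \<open>v\<close> the solution stays at distance at least \<open>1\<close> inside this radius.\<close>
  define R where "R t = norm X0 + v * \<bar>t - t0\<bar> + 1" for t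
  have Rpos: "R t > 0" for t
    using \<open>v \<ge> 0\<close> by (simp add: R_def add_nonneg_pos)
  have contR: "continuous_on UNIV R"
    unfolding R_def by (intro continuous_intros)
  define L where "L t = 9 * \<gamma> * \<delta> powr (- \<gamma> - 1) * R t ^ 4 + 6 * \<delta> powr (- \<gamma>) * R t" for t
  have Lpos: "L t \<ge> 0" for t
    using Rpos[of t] \<open>\<gamma> > 1\<close> by (simp add: L_def)
  define G where "G t X = regular_force \<gamma> \<delta> (trunc (R t) X)" for t X
  have G_lip: "norm (G t X - G t Y) \<le> L t * norm (X - Y)" for t X Y
  proof -
    have "norm (G t X - G t Y) \<le> L t * norm (trunc (R t) X - trunc (R t) Y)"
      unfolding G_def L_def using assms \<open>\<delta> > 0\<close> Rpos
      by (intro regular_force_lipschitz norm_trunc_le) auto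
    also have "\<dots> \<le> L t * norm (X - Y)"
      by (intro mult_left_mono trunc_lipschitz Rpos Lpos)
    finally show ?thesis .
  qed
  have G0: "G t 0 = 0" for t
    by (simp add: G_def trunc_def regular_force_def cof_def polar_cof.zero_left)
  define f where "f t y = (snd y, G t (fst y))" for t and y :: "(real^3^3) \<times> (real^3^3)"
  obtain y where y0: "y t0 = (X0, V0)" and y: "\<And>t. (y has_vector_derivative f t (y t)) (at t)"
  proof (rule global_ode_solution[of f "\<lambda>t. 1 + L t" t0 "(X0, V0)"])
    show "continuous_on UNIV (\<lambda>(t, x). f t x)"
      unfolding f_def G_def regular_force_def case_prod_unfold using Rpos \<open>\<delta> > 0\<close>
      by (intro continuous_intros continuous_on_trunc continuous_on_compose2[OF contR]) auto
    show "continuous_on UNIV (\<lambda>t. 1 + L t)"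
      unfolding L_def by (intro continuous_intros contR)
    show "norm (f t 0) \<le> 1 + L t" for t
      using Lpos[of t] by (simp add: f_def G0)
    fix t x y
    have "norm (f t x - f t y) \<le> norm (snd x - snd y) + norm (G t (fst x) - G t (fst y))"
      by (simp add: f_def norm_Pair_le)
    also have "\<dots> \<le> norm (snd x - snd y) + L t * norm (fst x - fst y)"
      using G_lip by simp
    also have "\<dots> \<le> norm (x - y) + L t * norm (x - y)"
    proof (intro add_mono mult_left_mono Lpos)
      show "norm (snd x - snd y) \<le> norm (x - y)" "norm (fst x - fst y) \<le> norm (x - y)"
        by (metis norm_snd_le prod.collapse snd_diff) (metis norm_fst_le prod.collapse fst_diff)
    qed
    finally show "norm (f t x - f t y) \<le> (1 + L t) * norm (x - y)" by (simp add: algebra_simps)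
  qed (rule that)
  define A V where "A = fst \<circ> y" and "V = snd \<circ> y"
  have A0: "A t0 = X0" and V0: "V t0 = V0" using y0 by (simp_all add: A_def V_def)
  have A: "(A has_vector_derivative V t) (at t)" for t
    using bounded_linear.has_vector_derivative[OF bounded_linear_fst y[of t]]
    by (simp add: A_def V_def f_def comp_def)
  have V: "(V has_vector_derivative G t (A t)) (at t)" for t
    using bounded_linear.has_vector_derivative[OF bounded_linear_snd y[of t]]
    by (simp add: A_def V_def f_def comp_def)
  have contA: "continuous_on UNIV A"
    by (rule has_vector_derivative_imp_continuous_on) (rule A)
  have sol: "solution_on \<gamma> S A V" if "\<And>t. t \<in> S \<Longrightarrow> det (A t) \<ge> \<delta> \<and> norm (A t) \<le> R t" for S
    unfolding solution_on_def
  proof (intro ballI conjI A)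
    fix t assume t: "t \<in> S"
    then show "det (A t) > 0" using that[OF t] \<open>\<delta> > 0\<close> by auto
    have "G t (A t) = force \<gamma> (A t)"
      using that[OF t] Rpos by (simp add: G_def trunc_eq regular_force_eq)
    then show "(V has_vector_derivative force \<gamma> (A t)) (at t)" using V[of t] by simp
  qed
  have good: "det (A t) > \<delta> \<and> norm (A t) < R t" for t
  proof (rule ccontr)
    define Bad where "Bad = {t. det (A t) \<le> \<delta> \<or> R t \<le> norm (A t)}"
    assume "\<not> (det (A t) > \<delta> \<and> norm (A t) < R t)"
    then have "Bad \<noteq> {}" by (auto simp: Bad_def not_less)
    moreover have "closed Bad"
      unfolding Bad_def by (intro closed_Collect_disj closed_Collect_le continuous_intros contA contR)
    ultimately obtain \<tau> where \<tau>: "\<tau> \<in> Bad" "\<And>t. t \<in> Bad \<Longrightarrow> dist t0 \<tau> \<le> dist t0 t"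
      using distance_attains_inf[of Bad t0] by metis
    have "t0 \<notin> Bad"
      using energy_controls(2)[OF assms, of V0 E] \<open>\<delta> < d\<close> \<open>v \<ge> 0\<close>
      by (auto simp: Bad_def A0 E_def[symmetric] d_def[symmetric] R_def)
    then have "t0 \<noteq> \<tau>" using \<tau>(1) by auto
    have "open_segment t0 \<tau> \<subseteq> {t. \<delta> \<le> det (A t) \<and> norm (A t) \<le> R t}"
    proof
      fix t assume "t \<in> open_segment t0 \<tau>"
      then have "dist t0 t < dist t0 \<tau>" by (metis dist_in_open_segment dist_commute)
      then have "t \<notin> Bad" using \<tau>(2)[of t] by auto
      then show "t \<in> {t. \<delta> \<le> det (A t) \<and> norm (A t) \<le> R t}" by (auto simp: Bad_def)
    qed
    moreover have "closed {t. \<delta> \<le> det (A t) \<and> norm (A t) \<le> R t}"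
      by (intro closed_Collect_conj closed_Collect_le continuous_intros contA contR)
    ultimately have "closed_segment t0 \<tau> \<subseteq> {t. \<delta> \<le> det (A t) \<and> norm (A t) \<le> R t}"
      using closure_minimal closure_open_segment[of t0 \<tau>] \<open>t0 \<noteq> \<tau>\<close> by metis
    then have S: "solution_on \<gamma> (closed_segment t0 \<tau>) A V"
      by (intro sol) blast
    have en: "energy \<gamma> (A t) (V t) = E" if "t \<in> closed_segment t0 \<tau>" for t
      using energy_conserved[OF S convex_closed_segment that ends_in_segment(1) \<open>\<gamma> > 1\<close>]
      by (simp add: A0 V0 E_def)
    have "det (A \<tau>) \<ge> d"
      unfolding d_def using energy_controls(2)[OF \<open>\<gamma> > 1\<close> solution_onD(1)[OF S] eq_refl[OF en]] by simp
    moreover have "norm (A \<tau> - A t0) \<le> v * norm (\<tau> - t0)"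
    proof (rule differentiable_bound[where S = "closed_segment t0 \<tau>" and f' = "\<lambda>t h. h *\<^sub>R V t"])
      fix t assume t: "t \<in> closed_segment t0 \<tau>"
      show "(A has_derivative (\<lambda>h. h *\<^sub>R V t)) (at t within closed_segment t0 \<tau>)"
        using A[of t] by (simp add: has_vector_derivative_def has_derivative_at_withinI)
      have "norm (V t) \<le> v"
        unfolding v_def by (rule energy_controls(1)[OF \<open>\<gamma> > 1\<close> solution_onD(1)[OF S t] eq_refl[OF en[OF t]]])
      then show "onorm (\<lambda>h. h *\<^sub>R V t) \<le> v"
        by (intro onorm_le) (simp add: mult.commute[of v] mult_left_mono)
    qed auto
    then have "norm (A \<tau>) < R \<tau>"
      using norm_triangle_ineq2[of "A \<tau>" "A t0"] by (simp add: A0 R_def)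
    ultimately show False using \<tau>(1) \<open>\<delta> < d\<close> by (auto simp: Bad_def)
  qed
  have "solution_on \<gamma> UNIV A V"
    using good by (intro sol) (simp add: less_imp_le)
  with A0 V0 show ?thesis by (rule that)
qed

text \<open>
  On a compact interval both solutions stay in a set where the force is Lipschitz, and Gronwall's lemma applies to
  the squared distance in phase space.
\<close>

lemma solutions_agree:
  assumes sol1: "solution_on \<gamma> {a..b} A1 V1" and sol2: "solution_on \<gamma> {a..b} A2 V2"
    and c: "c \<in> {a..b}" "A1 c = A2 c" "V1 c = V2 c" and "t \<in> {a..b}" and "\<gamma> \<ge> 0"
  shows "A1 t = A2 t" "V1 t = V2 t"
proof -
  have cont: "continuous_on {a..b} A1" "continuous_on {a..b} A2"
    using has_vector_derivative_imp_continuous_on solution_onD(2)[OF sol1] solution_onD(2)[OF sol2] by blast+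
  have "{a..b} \<noteq> {}" using c by auto
  have "bounded (A1 ` {a..b})" "bounded (A2 ` {a..b})"
    using cont by (auto intro!: compact_imp_bounded compact_continuous_image)
  then obtain R1 R2 where "\<And>s. s \<in> {a..b} \<Longrightarrow> norm (A1 s) \<le> R1" "\<And>s. s \<in> {a..b} \<Longrightarrow> norm (A2 s) \<le> R2"
    unfolding bounded_iff by (metis imageI)
  then obtain R where R: "\<And>s. s \<in> {a..b} \<Longrightarrow> norm (A1 s) \<le> R" "\<And>s. s \<in> {a..b} \<Longrightarrow> norm (A2 s) \<le> R"
    by (metis max.coboundedI1 max.coboundedI2)
  have "\<exists>m>0. \<forall>s\<in>{a..b}. m \<le> det (A s)" if "continuous_on {a..b} A" "solution_on \<gamma> {a..b} A V" for A V
  proof -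
    have "continuous_on {a..b} (\<lambda>s. det (A s))" by (intro continuous_intros that)
    then obtain s where "s \<in> {a..b}" "\<forall>u\<in>{a..b}. det (A s) \<le> det (A u)"
      using continuous_attains_inf[OF compact_Icc \<open>{a..b} \<noteq> {}\<close>] by blast
    then show ?thesis using solution_onD(1)[OF that(2)] by blast
  qed
  from this[OF cont(1) sol1] this[OF cont(2) sol2] obtain m1 m2 where
    "m1 > 0" "m2 > 0" "\<And>s. s \<in> {a..b} \<Longrightarrow> m1 \<le> det (A1 s)" "\<And>s. s \<in> {a..b} \<Longrightarrow> m2 \<le> det (A2 s)" by blast
  then obtain \<delta> where \<delta>: "\<delta> > 0" "\<And>s. s \<in> {a..b} \<Longrightarrow> \<delta> \<le> det (A1 s)" "\<And>s. s \<in> {a..b} \<Longrightarrow> \<delta> \<le> det (A2 s)"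
    by (metis min.coboundedI1 min.coboundedI2 min_less_iff_conj)
  define L where "L = 9 * \<gamma> * \<delta> powr (- \<gamma> - 1) * R^4 + 6 * \<delta> powr (- \<gamma>) * R"
  have "R \<ge> 0" using R(1)[OF c(1)] norm_ge_zero order_trans by blast
  then have "L \<ge> 0" using \<open>\<gamma> \<ge> 0\<close> by (simp add: L_def)
  have lip: "norm (force \<gamma> (A1 s) - force \<gamma> (A2 s)) \<le> L * norm (A1 s - A2 s)" if "s \<in> {a..b}" for s
    using regular_force_lipschitz[OF \<delta>(1) \<open>\<gamma> \<ge> 0\<close> R(1)[OF that] R(2)[OF that]] \<delta>(2,3)[OF that]
    by (simp add: L_def regular_force_eq)
  define D W where "D s = A1 s - A2 s" and "W s = V1 s - V2 s" for s
  define F where "F s = force \<gamma> (A1 s) - force \<gamma> (A2 s)" for s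
  define N where "N s = D s \<bullet> D s + W s \<bullet> W s" for s
  define N' where "N' s = 2 * (D s \<bullet> W s + W s \<bullet> F s)" for s
  have der: "(N has_real_derivative N' s) (at s)" if "s \<in> {a..b}" for s
  proof -
    have D: "(D has_vector_derivative W s) (at s)" and W: "(W has_vector_derivative F s) (at s)"
      unfolding D_def W_def F_def
      by (intro has_vector_derivative_diff solution_onD[OF sol1 that] solution_onD[OF sol2 that])+
    have "(N has_vector_derivative (D s \<bullet> W s + W s \<bullet> D s) + (W s \<bullet> F s + F s \<bullet> W s)) (at s)"
      unfolding N_def
      by (intro has_vector_derivative_add bounded_bilinear.has_vector_derivative[OF bounded_bilinear_inner] D W)
    then show ?thesis
      by (simp add: N'_def has_real_derivative_iff_has_vector_derivative inner_commute)
  qed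
  have bnd: "\<bar>N' s\<bar> \<le> (1 + L) * N s" if "s \<in> {a..b}" for s
  proof -
    have "\<bar>D s \<bullet> W s + W s \<bullet> F s\<bar> \<le> norm (D s) * norm (W s) + norm (W s) * norm (F s)"
      using Cauchy_Schwarz_ineq2[of "D s" "W s"] Cauchy_Schwarz_ineq2[of "W s" "F s"] by linarith
    also have "\<dots> \<le> norm (D s) * norm (W s) + norm (W s) * (L * norm (D s))"
      using lip[OF that] by (intro add_mono mult_left_mono) (auto simp: F_def D_def)
    also have "\<dots> = (1 + L) * (norm (D s) * norm (W s))" by (simp add: algebra_simps)
    finally have "\<bar>N' s\<bar> \<le> (1 + L) * (2 * norm (D s) * norm (W s))"
      by (simp add: N'_def abs_mult)
    also have "\<dots> \<le> (1 + L) * N s"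
      using sum_squares_bound[of "norm (D s)" "norm (W s)"] \<open>L \<ge> 0\<close>
      by (intro mult_left_mono) (auto simp: N_def power2_norm_eq_inner)
    finally show ?thesis .
  qed
  have Nc: "N c = 0" using c by (simp add: N_def D_def W_def)
  have "N t \<le> 0"
  proof (cases "c \<le> t")
    case True
    show ?thesis
    proof (rule gronwall_zero_forward[OF True, of N N' "1 + L"])
      fix s assume "c \<le> s" "s \<le> t"
      then have s: "s \<in> {a..b}" using c \<open>t \<in> {a..b}\<close> by auto
      show "(N has_real_derivative N' s) (at s)" by (rule der[OF s])
      show "N' s \<le> (1 + L) * N s" using bnd[OF s] by linarith
    qed (rule Nc)
  next
    case False
    then have "t \<le> c" by simp
    then show ?thesis
    proof (rule gronwall_zero_backward[of t c N N' "1 + L"])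
      fix s assume "t \<le> s" "s \<le> c"
      then have s: "s \<in> {a..b}" using c \<open>t \<in> {a..b}\<close> by auto
      show "(N has_real_derivative N' s) (at s)" by (rule der[OF s])
      show "- N' s \<le> (1 + L) * N s" using bnd[OF s] by linarith
    qed (rule Nc)
  qed
  then have "D t \<bullet> D t = 0" "W t \<bullet> W t = 0"
    using inner_ge_zero[of "D t"] inner_ge_zero[of "W t"] unfolding N_def by linarith+
  then show "A1 t = A2 t" "V1 t = V2 t" by (simp_all add: D_def W_def)
qed

section \<open>Solutions asymptotic to a straight line\<close>

lemma norm_affine_le: "t \<ge> 1 \<Longrightarrow> norm (A0 + t *\<^sub>R A1) \<le> (norm A0 + norm A1) * t"
  for A0 A1 :: "'a::real_normed_vector"
  using norm_triangle_ineq[of A0 "t *\<^sub>R A1"] mult_left_mono[of 1 t "norm A0"]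
  by (simp add: algebra_simps)

text \<open>
  With \<open>\<delta> = \<kappa> t\<close> and \<open>R = a t\<close> the two terms of the Lipschitz constant are of order \<open>t\<^bsup>3-\<gamma>\<^esup>\<close> and
  \<open>t\<^bsup>1-\<gamma>\<^esup>\<close>.
\<close>

lemma regular_force_growth_lipschitz:
  assumes "t \<ge> 1" "\<kappa> > 0" "\<gamma> \<ge> 0" "a \<ge> 0" "norm X \<le> a * t" "norm Y \<le> a * t"
  shows "norm (regular_force \<gamma> (\<kappa> * t) X - regular_force \<gamma> (\<kappa> * t) Y)
    \<le> (9 * \<gamma> * \<kappa> powr (- \<gamma> - 1) * a^4 + 6 * \<kappa> powr (- \<gamma>) * a) * t powr (- (\<gamma> - 3)) * norm (X - Y)"
proof -
  have t: "t > 0" using assms by simp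
  have "(\<kappa> * t) powr (- \<gamma> - 1) * (a * t)^4 = \<kappa> powr (- \<gamma> - 1) * a^4 * (t powr (- \<gamma> - 1) * t powr 4)"
    using t assms by (simp add: powr_mult power_mult_distrib)
  also have "t powr (- \<gamma> - 1) * t powr 4 = t powr (- (\<gamma> - 3))"
    by (simp flip: powr_add)
  finally have 1: "(\<kappa> * t) powr (- \<gamma> - 1) * (a * t)^4 = \<kappa> powr (- \<gamma> - 1) * a^4 * t powr (- (\<gamma> - 3))" .
  have "(\<kappa> * t) powr (- \<gamma>) * (a * t) = \<kappa> powr (- \<gamma>) * a * (t powr (- \<gamma>) * t powr 1)"
    using t assms by (simp add: powr_mult)
  also have "t powr (- \<gamma>) * t powr 1 = t powr (1 - \<gamma>)"
    unfolding powr_add[symmetric] by simp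
  also have "\<kappa> powr (- \<gamma>) * a * \<dots> \<le> \<kappa> powr (- \<gamma>) * a * t powr (- (\<gamma> - 3))"
    using assms by (intro mult_left_mono powr_mono) auto
  finally have 2: "(\<kappa> * t) powr (- \<gamma>) * (a * t) \<le> \<kappa> powr (- \<gamma>) * a * t powr (- (\<gamma> - 3))" .
  have "9 * \<gamma> * (\<kappa> * t) powr (- \<gamma> - 1) * (a * t)^4 + 6 * (\<kappa> * t) powr (- \<gamma>) * (a * t)
      = 9 * \<gamma> * ((\<kappa> * t) powr (- \<gamma> - 1) * (a * t)^4) + 6 * ((\<kappa> * t) powr (- \<gamma>) * (a * t))"
    by simp
  also have "\<dots> \<le> 9 * \<gamma> * (\<kappa> powr (- \<gamma> - 1) * a^4 * t powr (- (\<gamma> - 3)))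
      + 6 * (\<kappa> powr (- \<gamma>) * a * t powr (- (\<gamma> - 3)))"
    unfolding 1 using 2 by simp
  also have "\<dots> = (9 * \<gamma> * \<kappa> powr (- \<gamma> - 1) * a^4 + 6 * \<kappa> powr (- \<gamma>) * a) * t powr (- (\<gamma> - 3))"
    by (simp add: algebra_simps)
  finally have "(9 * \<gamma> * (\<kappa> * t) powr (- \<gamma> - 1) * (a * t)^4 + 6 * (\<kappa> * t) powr (- \<gamma>) * (a * t)) * norm (X - Y)
    \<le> (9 * \<gamma> * \<kappa> powr (- \<gamma> - 1) * a^4 + 6 * \<kappa> powr (- \<gamma>) * a) * t powr (- (\<gamma> - 3)) * norm (X - Y)"
    by (rule mult_right_mono) simp
  then show ?thesis
    using regular_force_lipschitz[of "\<kappa> * t" \<gamma> X "a * t" Y] assms t by (auto intro: order_trans)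
qed

text \<open>
  The terminal value problem is solved for the force cut off at determinant \<open>k t / 2\<close> and at distance \<open>1\<close> from the
  line.  Its solution is so close to the line that neither cut-off is active for large \<open>t\<close>.
\<close>

lemma exists_asymptotic_solution:
  assumes "\<gamma> > 5" "k > 0" and det_growth: "\<forall>\<^sub>F t in at_top. det (A0 + t *\<^sub>R A1) \<ge> k * t"
  obtains T A V where "solution_on \<gamma> {T..} A V" "((\<lambda>t. A t - (A0 + t *\<^sub>R A1)) \<longlongrightarrow> 0) at_top"
proof -
  define Ai where "Ai t = A0 + t *\<^sub>R A1" for t
  \<comment> \<open>The summand \<open>1\<close> absorbs the retracted perturbation when \<open>t \<ge> 1\<close>.\<close>
  define a where "a = norm A0 + norm A1 + 1"
  have "a \<ge> 1" by (simp add: a_def)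
  define \<kappa> where "\<kappa> = k / 2"
  have "\<kappa> > 0" using \<open>k > 0\<close> by (simp add: \<kappa>_def)
  define p q where "p = \<gamma> - 2" and "q = \<gamma> - 3"
  have "p > 2" "q > 2" using \<open>\<gamma> > 5\<close> by (simp_all add: p_def q_def)
  define M where "M = 3 * \<kappa> powr (- \<gamma>) * a\<^sup>2"
  define L where "L = 9 * \<gamma> * \<kappa> powr (- \<gamma> - 1) * a^4 + 6 * \<kappa> powr (- \<gamma>) * a"
  have "L \<ge> 0" using \<open>a \<ge> 1\<close> \<open>\<gamma> > 5\<close> by (simp add: L_def)
  define G where "G t X = regular_force \<gamma> (\<kappa> * t) (Ai t + trunc 1 X)" for t X
  have Ai_le: "norm (Ai t + trunc 1 X) \<le> a * t" if "t \<ge> 1" for t X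
    using norm_affine_le[OF that, of A0 A1] norm_trunc_le[of 1 X] that
      norm_triangle_ineq[of "Ai t" "trunc 1 X"] by (simp add: a_def Ai_def algebra_simps)
  have "((\<lambda>t. L / ((q - 1) * (q - 2)) * t powr (2 - q)) \<longlongrightarrow> 0) at_top"
    using \<open>q > 2\<close> by (intro powr_decay_at_top) auto
  then have "\<forall>\<^sub>F t in at_top. L / ((q - 1) * (q - 2)) * t powr (2 - q) < 1/2"
    by (rule order_tendstoD) auto
  then have "\<forall>\<^sub>F t in at_top. L / ((q - 1) * (q - 2)) * t powr (2 - q) < 1/2 \<and> t \<ge> 1"
    using eventually_ge_at_top by (rule eventually_conj)
  then obtain T where T: "L / ((q - 1) * (q - 2)) * T powr (2 - q) < 1/2" "T \<ge> 1"
    using eventually_happens[of _ "at_top :: real filter"] by auto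
  have G_cont: "continuous_on ({T..} \<times> UNIV) (\<lambda>(t, X). G t X)"
  proof -
    have nonzero: "max (\<kappa> * t) d \<noteq> 0" if "t \<ge> T" for t d
    proof -
      have "\<kappa> * t > 0" using T(2) that \<open>\<kappa> > 0\<close> by (intro mult_pos_pos) auto
      then show ?thesis by (metis less_max_iff_disj less_irrefl)
    qed
    show ?thesis
      unfolding G_def Ai_def regular_force_def case_prod_unfold
      by (intro continuous_intros continuous_on_trunc) (auto simp: nonzero)
  qed
  have G_bound: "norm (G t X) \<le> M * t powr (- p)" if "t \<ge> T" for t X
  proof -
    have t: "t \<ge> 1" using T that by simp
    have "norm (G t X) \<le> 3 * (\<kappa> * t) powr (- \<gamma>) * (a * t)\<^sup>2"
      unfolding G_def using \<open>\<kappa> > 0\<close> t \<open>\<gamma> > 5\<close> by (intro regular_force_bound Ai_le) auto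
    also have "\<dots> = M * (t powr (- \<gamma>) * t powr 2)"
      using t \<open>\<kappa> > 0\<close> by (simp add: M_def powr_mult power_mult_distrib)
    also have "t powr (- \<gamma>) * t powr 2 = t powr (- p)"
      by (simp add: p_def flip: powr_add)
    finally show ?thesis .
  qed
  have G_lip: "norm (G t X - G t Y) \<le> L * t powr (- q) * norm (X - Y)" if "t \<ge> T" for t X Y
  proof -
    have t: "t \<ge> 1" using T that by simp
    have "norm (G t X - G t Y) \<le> L * t powr (- q) * norm ((Ai t + trunc 1 X) - (Ai t + trunc 1 Y))"
      unfolding G_def L_def q_def using \<open>\<kappa> > 0\<close> t \<open>\<gamma> > 5\<close> \<open>a \<ge> 1\<close>
      by (intro regular_force_growth_lipschitz Ai_le) auto
    also have "\<dots> \<le> L * t powr (- q) * norm (X - Y)"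
      using trunc_lipschitz[of 1 X Y] \<open>L \<ge> 0\<close> by (intro mult_left_mono) auto
    finally show ?thesis .
  qed
  have "T > 0" using T by simp
  obtain B B' where B: "\<And>t. t > T \<Longrightarrow> (B has_vector_derivative B' t) (at t)"
      "\<And>t. t > T \<Longrightarrow> (B' has_vector_derivative G t (B t)) (at t)"
      "\<And>t. t > T \<Longrightarrow> norm (B t) \<le> M / ((p - 1) * (p - 2)) * t powr (2 - p)"
    by (rule terminal_value_solution[OF \<open>T > 0\<close> \<open>p > 2\<close> \<open>q > 2\<close> G_cont G_bound G_lip \<open>L \<ge> 0\<close>
        less_imp_le[OF T(1)]]) (assumption | rule that)+
  define M' where "M' = M / ((p - 1) * (p - 2))"
  have B_le: "norm (B t) \<le> M' * t powr (2 - p)" if "t > T" for t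
    using B(3)[OF that] by (simp add: M'_def)
  have decay: "((\<lambda>t. M' * t powr (2 - p)) \<longlongrightarrow> 0) at_top"
    using \<open>p > 2\<close> by (intro powr_decay_at_top) auto
  have "((\<lambda>t. 3 * a\<^sup>2 * M' * t powr (3 - p)) \<longlongrightarrow> 0) at_top"
    using \<open>q > 2\<close> by (intro powr_decay_at_top) (auto simp: p_def q_def)
  then have "\<forall>\<^sub>F t in at_top. 3 * a\<^sup>2 * M' * t powr (3 - p) < \<kappa>"
    using \<open>\<kappa> > 0\<close> by (rule order_tendstoD)
  moreover have "\<forall>\<^sub>F t in at_top. M' * t powr (2 - p) < 1"
    using decay by (rule order_tendstoD) simp
  ultimately have "\<forall>\<^sub>F t in at_top. solution_on \<gamma> {t} (\<lambda>t. Ai t + B t) (\<lambda>t. A1 + B' t)"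
    using det_growth eventually_gt_at_top[of T]
  proof eventually_elim
    case (elim t)
    have "t \<ge> 1" using elim T by simp
    have B1: "norm (B t) \<le> 1" using B_le elim by (meson less_imp_le order_trans)
    have X_le: "norm (Ai t + B t) \<le> a * t"
      using Ai_le[OF \<open>t \<ge> 1\<close>, of "B t"] B1 by (simp add: trunc_eq)
    have A_le: "norm (Ai t) \<le> a * t"
      using Ai_le[OF \<open>t \<ge> 1\<close>, of 0] by (simp add: trunc_eq)
    have "\<bar>det (Ai t + B t) - det (Ai t)\<bar> \<le> 3 * (a * t)\<^sup>2 * norm (B t)"
      using det_diff_le[OF X_le A_le] by simp
    also have "\<dots> \<le> 3 * (a * t)\<^sup>2 * (M' * t powr (2 - p))"
      using B_le elim by (intro mult_left_mono) auto
    also have "\<dots> = (3 * a\<^sup>2 * M' * t powr (3 - p)) * t"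
    proof -
      have "t powr (3 - p) = t powr (2 - p) * t"
        using powr_add[of t "2 - p" 1] \<open>t \<ge> 1\<close> by simp
      then show ?thesis by (simp add: power_mult_distrib power2_eq_square mult_ac)
    qed
    also have "\<dots> \<le> \<kappa> * t" using elim \<open>t \<ge> 1\<close> by (intro mult_right_mono) auto
    finally have "det (Ai t + B t) \<ge> \<kappa> * t"
      using elim(3) unfolding \<kappa>_def Ai_def by linarith
    moreover have "\<kappa> * t > 0" using \<open>\<kappa> > 0\<close> \<open>t \<ge> 1\<close> by simp
    ultimately have pos: "det (Ai t + B t) > 0" and G: "G t (B t) = force \<gamma> (Ai t + B t)"
      using B1 by (simp_all add: G_def trunc_eq regular_force_eq)
    have "((\<lambda>t. Ai t + B t) has_vector_derivative A1 + B' t) (at t)"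
      unfolding Ai_def using B(1)[of t] elim by (auto intro!: derivative_eq_intros)
    moreover have "((\<lambda>t. A1 + B' t) has_vector_derivative force \<gamma> (Ai t + B t)) (at t)"
      using B(2)[of t] elim G by (auto intro!: derivative_eq_intros)
    ultimately show ?case using pos by (simp add: solution_on_def)
  qed
  then obtain T' where T': "\<And>t. t \<ge> T' \<Longrightarrow> solution_on \<gamma> {t} (\<lambda>t. Ai t + B t) (\<lambda>t. A1 + B' t)"
    unfolding eventually_at_top_linorder by blast
  show ?thesis
  proof (rule that)
    show "solution_on \<gamma> {T'..} (\<lambda>t. Ai t + B t) (\<lambda>t. A1 + B' t)"
      using T' by (simp add: solution_on_def)
    have "(B \<longlongrightarrow> 0) at_top"
      by (rule Lim_null_comparison[OF eventually_mono[OF eventually_gt_at_top[of T]] decay]) (rule B_le)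
    then show "((\<lambda>t. Ai t + B t - (A0 + t *\<^sub>R A1)) \<longlongrightarrow> 0) at_top"
      by (simp add: Ai_def)
  qed
qed

text \<open>
  Here \<open>A t = t A1 + O(1)\<close>, so \<open>cof (A t) = t\<^sup>2 cof A1 + O(t)\<close> and the inner product is dominated by
  \<open>t\<^sup>2 \<bar>cof A1\<bar>\<^sup>2\<close>, unless \<open>cof A1\<close> vanishes.
\<close>

lemma eventually_cof_inner_nonneg:
  assumes "\<forall>\<^sub>F t in at_top. norm (A t - t *\<^sub>R A1) \<le> c"
  shows "\<forall>\<^sub>F t in at_top. cof A1 \<bullet> cof (A t) \<ge> 0"
proof (cases "cof A1 = 0")
  case False
  define n where "n = norm (cof A1)"
  have "n > 0" using False by (simp add: n_def)
  have "\<forall>\<^sub>F t in at_top. n^2 * t^2 - n * (6 * norm A1 * c) * t - n * (3 * c^2) \<ge> 0"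
    using \<open>n > 0\<close> by real_asymp
  then show ?thesis using assms eventually_ge_at_top[of 0]
  proof eventually_elim
    case (elim t)
    define C where "C = A t - t *\<^sub>R A1"
    have "cof (A t) = cof (t *\<^sub>R A1 + C)" by (simp add: C_def)
    also have "\<dots> = t^2 *\<^sub>R cof A1 + (2 * t) *\<^sub>R polar_cof A1 C + cof C"
      by (simp add: cof_add cof_scaleR polar_cof.scaleR_left)
    finally have eq: "cof A1 \<bullet> cof (A t) = n^2 * t^2 + 2 * t * (cof A1 \<bullet> polar_cof A1 C) + cof A1 \<bullet> cof C"
      by (simp add: inner_add_right n_def power2_norm_eq_inner)
    have "- (cof A1 \<bullet> polar_cof A1 C) \<le> n * norm (polar_cof A1 C)"
      using Cauchy_Schwarz_ineq2[of "cof A1" "polar_cof A1 C"] by (simp add: n_def)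
    also have "\<dots> \<le> n * (3 * norm A1 * norm C)"
      using \<open>n > 0\<close> by (intro mult_left_mono norm_polar_cof_le) auto
    also have "\<dots> \<le> n * (3 * norm A1 * c)"
      using \<open>n > 0\<close> elim(2) by (intro mult_left_mono) (auto simp: C_def)
    finally have "2 * t * - (cof A1 \<bullet> polar_cof A1 C) \<le> 2 * t * (n * (3 * norm A1 * c))"
      using elim(3) by (intro mult_left_mono) auto
    also have "\<dots> = n * (6 * norm A1 * c) * t" by simp
    finally have linear: "- (2 * t * (cof A1 \<bullet> polar_cof A1 C)) \<le> n * (6 * norm A1 * c) * t"
      unfolding mult_minus_right .
    have "- (cof A1 \<bullet> cof C) \<le> n * norm (cof C)"
      using Cauchy_Schwarz_ineq2[of "cof A1" "cof C"] by (simp add: n_def)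
    also have "\<dots> \<le> n * (3 * c^2)"
      using \<open>n > 0\<close> elim(2) by (intro mult_left_mono norm_cof_le) (auto simp: C_def)
    finally have const: "- (cof A1 \<bullet> cof C) \<le> n * (3 * c^2)" .
    show ?case using elim(1) eq linear const by linarith
  qed
qed simp

text \<open>
  In the Taylor expansion of the determinant about the line, the only correction not evidently \<open>o(t)\<close> is
  \<open>t\<^sup>2 (cof A1 \<bullet> B)\<close>.  It is nonnegative, because \<open>cof A1 \<bullet> B\<close> is eventually convex and tends to zero.
\<close>

lemma solution_det_growth:
  assumes sol: "solution_on \<gamma> {T..} A V" and lim: "((\<lambda>t. A t - (A0 + t *\<^sub>R A1)) \<longlongrightarrow> 0) at_top"
    and "k > 0" and det_growth: "\<forall>\<^sub>F t in at_top. det (A0 + t *\<^sub>R A1) \<ge> k * t"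
  shows "\<forall>\<^sub>F t in at_top. det (A t) \<ge> k / 2 * t"
proof -
  define B where "B t = A t - (A0 + t *\<^sub>R A1)" for t
  have B0: "(B \<longlongrightarrow> 0) at_top" using lim by (simp add: B_def[abs_def])
  have B_small: "\<forall>\<^sub>F t in at_top. norm (B t) < e" if "e > 0" for e
    using tendstoD[OF B0 that] by simp
  have "\<forall>\<^sub>F t in at_top. norm (A t - t *\<^sub>R A1) \<le> norm A0 + 1"
    using B_small[of 1, OF zero_less_one]
  proof eventually_elim
    case (elim t)
    then show ?case using norm_triangle_ineq[of A0 "B t"] by (simp add: B_def)
  qed
  then have "\<forall>\<^sub>F t in at_top. cof A1 \<bullet> cof (A t) \<ge> 0" by (rule eventually_cof_inner_nonneg)
  then obtain T1 where T1: "\<And>t. t \<ge> T1 \<Longrightarrow> cof A1 \<bullet> cof (A t) \<ge> 0"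
    unfolding eventually_at_top_linorder by blast
  have h: "cof A1 \<bullet> B t \<ge> 0" if "t \<ge> max T T1" for t
  proof (rule eventually_convex_decay_nonneg[OF _ _ _ _ that])
    show "((\<lambda>t. cof A1 \<bullet> B t) \<longlongrightarrow> 0) at_top"
      using tendsto_inner[OF tendsto_const B0, of "cof A1"] by simp
    fix t assume t: "t \<ge> max T T1"
    then have S: "t \<in> {T..}" by simp
    have B': "(B has_vector_derivative V t - A1) (at t)"
      unfolding B_def using solution_onD(2)[OF sol S] by (auto intro!: derivative_eq_intros)
    show "((\<lambda>t. cof A1 \<bullet> B t) has_real_derivative cof A1 \<bullet> (V t - A1)) (at t)"
      unfolding has_real_derivative_iff_has_vector_derivative
      by (rule bounded_linear.has_vector_derivative[OF bounded_linear_inner_right B'])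
    have V': "((\<lambda>t. V t - A1) has_vector_derivative force \<gamma> (A t)) (at t)"
      using solution_onD(3)[OF sol S] by (auto intro!: derivative_eq_intros)
    show "((\<lambda>t. cof A1 \<bullet> (V t - A1)) has_real_derivative cof A1 \<bullet> force \<gamma> (A t)) (at t)"
      unfolding has_real_derivative_iff_has_vector_derivative
      by (rule bounded_linear.has_vector_derivative[OF bounded_linear_inner_right V'])
    show "cof A1 \<bullet> force \<gamma> (A t) \<ge> 0"
      using T1[of t] t by (simp add: force_def)
  qed
  \<comment> \<open>For \<open>t \<ge> 1\<close> and \<open>\<bar>B t\<bar> \<le> 1\<close>, the corrections other than \<open>t\<^sup>2 (cof A1 \<bullet> B t)\<close> are at most \<open>K t \<bar>B t\<bar>\<close>.\<close>
  define K where "K = 3 * (norm A0)\<^sup>2 + 6 * norm A0 * norm A1 + 3 * (norm A0 + norm A1) + 1"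
  have "K > 0" by (simp add: K_def add_nonneg_pos)
  define e where "e = min 1 (k / 2 / K)"
  have "e > 0" "e \<le> 1" "e * K \<le> k / 2" using \<open>k > 0\<close> \<open>K > 0\<close> by (auto simp: e_def min_def field_simps)
  show ?thesis
    using B_small[OF \<open>e > 0\<close>] det_growth eventually_ge_at_top[of "max T T1"] eventually_ge_at_top[of 1]
  proof eventually_elim
    case (elim t)
    let ?b = "norm (B t)"
    have b: "?b \<le> e" "?b \<le> 1" using elim \<open>e \<le> 1\<close> by auto
    have b2: "?b\<^sup>2 \<le> ?b" using b mult_left_le[of ?b ?b] by (simp add: power2_eq_square)
    have "det (A t) = det ((A0 + t *\<^sub>R A1) + B t)" by (simp add: B_def)
    also have "\<dots> = det (A0 + t *\<^sub>R A1) + cof (A0 + t *\<^sub>R A1) \<bullet> B t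
        + cof (B t) \<bullet> (A0 + t *\<^sub>R A1) + det (B t)"
      by (rule det_add)
    also have "cof (A0 + t *\<^sub>R A1) \<bullet> B t = cof A0 \<bullet> B t + 2 * t * (polar_cof A0 A1 \<bullet> B t) + t\<^sup>2 * (cof A1 \<bullet> B t)"
      by (simp add: cof_add cof_scaleR polar_cof.scaleR_right inner_add_left)
    finally have eq: "det (A t) = det (A0 + t *\<^sub>R A1) + (cof A0 \<bullet> B t + 2 * t * (polar_cof A0 A1 \<bullet> B t)
        + t\<^sup>2 * (cof A1 \<bullet> B t)) + cof (B t) \<bullet> (A0 + t *\<^sub>R A1) + det (B t)" .
    have 1: "- (cof A0 \<bullet> B t) \<le> 3 * (norm A0)\<^sup>2 * ?b"
      using Cauchy_Schwarz_ineq2[of "cof A0" "B t"] mult_right_mono[OF norm_cof_le[OF order_refl, of A0], of ?b]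
      by simp
    have c1: "3 * (norm A0)\<^sup>2 * ?b \<le> 3 * (norm A0)\<^sup>2 * ?b * t"
      using mult_left_mono[of 1 t "3 * (norm A0)\<^sup>2 * ?b"] elim by simp
    have 2: "- (polar_cof A0 A1 \<bullet> B t) \<le> 3 * norm A0 * norm A1 * ?b"
      using Cauchy_Schwarz_ineq2[of "polar_cof A0 A1" "B t"]
        mult_right_mono[OF norm_polar_cof_le[of A0 A1], of ?b] by simp
    have c2: "- (2 * t * (polar_cof A0 A1 \<bullet> B t)) \<le> 2 * t * (3 * norm A0 * norm A1 * ?b)"
      using mult_left_mono[OF 2, of "2 * t"] elim by simp
    have 3: "t\<^sup>2 * (cof A1 \<bullet> B t) \<ge> 0" using h elim by simp
    have "- (cof (B t) \<bullet> (A0 + t *\<^sub>R A1)) \<le> norm (cof (B t)) * norm (A0 + t *\<^sub>R A1)"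
      using Cauchy_Schwarz_ineq2[of "cof (B t)" "A0 + t *\<^sub>R A1"] by simp
    also have "\<dots> \<le> (3 * ?b) * ((norm A0 + norm A1) * t)"
      using norm_cof_le[OF order_refl, of "B t"] b2 elim by (intro mult_mono norm_affine_le) auto
    finally have 4: "- (cof (B t) \<bullet> (A0 + t *\<^sub>R A1)) \<le> (3 * ?b) * ((norm A0 + norm A1) * t)" .
    have "- det (B t) \<le> norm (cof (B t)) * ?b / 3"
      using Cauchy_Schwarz_ineq2[of "cof (B t)" "B t"] by (simp add: det_eq_cof_inner)
    also have "\<dots> \<le> (3 * ?b) * 1 / 3"
      using norm_cof_le[OF order_refl, of "B t"] b2 b by (intro divide_right_mono mult_mono) auto
    finally have "- det (B t) \<le> ?b" by simp
    also have "\<dots> \<le> ?b * t" using elim by (simp add: mult_le_cancel_left1)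
    finally have 5: "- det (B t) \<le> ?b * t" .
    have "3 * (norm A0)\<^sup>2 * ?b * t + 2 * t * (3 * norm A0 * norm A1 * ?b)
        + (3 * ?b) * ((norm A0 + norm A1) * t) + ?b * t = ?b * (K * t)"
      by (simp add: K_def algebra_simps)
    also have "\<dots> \<le> e * (K * t)" using b elim \<open>K > 0\<close> by (intro mult_right_mono) auto
    also have "\<dots> \<le> k / 2 * t"
      using mult_right_mono[OF \<open>e * K \<le> k / 2\<close>, of t] elim by (simp add: mult_ac)
    finally show "det (A t) \<ge> k / 2 * t" using eq 1 c1 c2 3 4 5 elim(2) by linarith
  qed
qed

lemma asymptotic_solutions_eventually_agree:
  assumes "\<gamma> > 5" "k > 0" and det_growth: "\<forall>\<^sub>F t in at_top. det (A0 + t *\<^sub>R A1) \<ge> k * t"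
    and sol: "solution_on \<gamma> {T..} A V" "solution_on \<gamma> {T..} C W"
    and lim: "((\<lambda>t. A t - (A0 + t *\<^sub>R A1)) \<longlongrightarrow> 0) at_top" "((\<lambda>t. C t - (A0 + t *\<^sub>R A1)) \<longlongrightarrow> 0) at_top"
  shows "\<forall>\<^sub>F t in at_top. A t = C t"
proof -
  define a where "a = norm A0 + norm A1 + 1"
  have "a \<ge> 0" by (simp add: a_def)
  have norm_le: "\<forall>\<^sub>F t in at_top. norm (X t) \<le> a * t" if "((\<lambda>t. X t - (A0 + t *\<^sub>R A1)) \<longlongrightarrow> 0) at_top" for X
    using tendstoD[OF that zero_less_one] eventually_ge_at_top[of 1]
  proof eventually_elim
    case (elim t)
    then show ?case
      using norm_affine_le[OF elim(2), of A0 A1] norm_triangle_ineq[of "X t - (A0 + t *\<^sub>R A1)" "A0 + t *\<^sub>R A1"]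
      by (simp add: a_def algebra_simps)
  qed
  define L where "L = 9 * \<gamma> * (k/2) powr (- \<gamma> - 1) * a^4 + 6 * (k/2) powr (- \<gamma>) * a"
  have "L \<ge> 0" using \<open>a \<ge> 0\<close> \<open>\<gamma> > 5\<close> by (simp add: L_def)
  have "\<forall>\<^sub>F t in at_top. A t - C t = 0"
  proof (rule eventually_zero_of_integrable_lipschitz[of "\<gamma> - 3" _ "\<lambda>t. V t - W t" "\<lambda>t. force \<gamma> (A t) - force \<gamma> (C t)" L])
    show "((\<lambda>t. A t - C t) \<longlongrightarrow> 0) at_top" using tendsto_diff[OF lim] by simp
    show "\<forall>\<^sub>F t in at_top. ((\<lambda>t. A t - C t) has_vector_derivative V t - W t) (at t)"
      by (rule eventually_mono[OF eventually_ge_at_top[of T]])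
        (intro has_vector_derivative_diff solution_onD(2)[OF sol(1)] solution_onD(2)[OF sol(2)]; simp)
    show "\<forall>\<^sub>F t in at_top. ((\<lambda>t. V t - W t) has_vector_derivative force \<gamma> (A t) - force \<gamma> (C t)) (at t)"
      by (rule eventually_mono[OF eventually_ge_at_top[of T]])
        (intro has_vector_derivative_diff solution_onD(3)[OF sol(1)] solution_onD(3)[OF sol(2)]; simp)
    show "\<forall>\<^sub>F t in at_top. norm (force \<gamma> (A t) - force \<gamma> (C t)) \<le> L * t powr (- (\<gamma> - 3)) * norm (A t - C t)"
      using norm_le[OF lim(1)] norm_le[OF lim(2)] eventually_ge_at_top[of 1]
        solution_det_growth[OF sol(1) lim(1) \<open>k > 0\<close> det_growth] solution_det_growth[OF sol(2) lim(2) \<open>k > 0\<close> det_growth]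
    proof eventually_elim
      case (elim t)
      then show ?case
        using regular_force_growth_lipschitz[of t "k/2" \<gamma> a "A t" "C t"] \<open>k > 0\<close> \<open>\<gamma> > 5\<close> \<open>a \<ge> 0\<close>
        by (simp add: L_def regular_force_eq)
    qed
  qed (use \<open>\<gamma> > 5\<close> \<open>L \<ge> 0\<close> in auto)
  then show ?thesis by simp
qed

section \<open>Smoothness and the main result\<close>

text \<open>
  Being \<open>n\<close> times differentiable on the whole line, in a form suited to induction on \<open>n\<close>: derivatives are given by
  witnesses instead of iterated derivative operators.
\<close>

primrec times_differentiable :: "nat \<Rightarrow> (real \<Rightarrow> 'a::real_normed_vector) \<Rightarrow> bool" where
  "times_differentiable 0 f \<longleftrightarrow> True"
| "times_differentiable (Suc n) f \<longleftrightarrow>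
     (\<exists>f'. (\<forall>t. (f has_vector_derivative f' t) (at t)) \<and> times_differentiable n f')"

lemma times_differentiable_SucI:
  "(\<And>t. (f has_vector_derivative f' t) (at t)) \<Longrightarrow> times_differentiable n f' \<Longrightarrow> times_differentiable (Suc n) f"
  by auto

lemma vderiv_eqI: "(\<And>t. (f has_vector_derivative f' t) (at t)) \<Longrightarrow> vderiv f = f'"
  unfolding vderiv_def by (rule ext) (rule vector_derivative_at)

lemma times_differentiable_SucD: "times_differentiable (Suc n) f \<Longrightarrow> times_differentiable n f"
proof (induction n arbitrary: f)
  case (Suc n)
  then obtain f' where "\<And>t. (f has_vector_derivative f' t) (at t)" "times_differentiable (Suc n) f'"
    unfolding times_differentiable.simps(2)[of "Suc n"] by blast
  then show ?case using Suc.IH by (blast intro: times_differentiable_SucI)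
qed simp

lemma times_differentiable_const: "times_differentiable n (\<lambda>_. c)"
proof (induction n arbitrary: c)
  case (Suc n)
  show ?case by (rule times_differentiable_SucI[OF has_vector_derivative_const Suc])
qed simp

lemma times_differentiable_add:
  "times_differentiable n f \<Longrightarrow> times_differentiable n g \<Longrightarrow> times_differentiable n (\<lambda>t. f t + g t)"
proof (induction n arbitrary: f g)
  case (Suc n)
  then obtain f' g' where "\<And>t. (f has_vector_derivative f' t) (at t)" "times_differentiable n f'"
    "\<And>t. (g has_vector_derivative g' t) (at t)" "times_differentiable n g'" by auto
  then show ?case
    by (intro times_differentiable_SucI[of _ "\<lambda>t. f' t + g' t"] has_vector_derivative_add Suc.IH)
qed simp

text \<open>
  The derivative is again a sum of values of \<open>h\<close>, so the product rule drives the induction.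
\<close>

lemma times_differentiable_bilinear:
  assumes h: "bounded_bilinear h"
  shows "times_differentiable n f \<Longrightarrow> times_differentiable n g \<Longrightarrow> times_differentiable n (\<lambda>t. h (f t) (g t))"
proof (induction n arbitrary: f g)
  case (Suc n)
  note fn = times_differentiable_SucD[OF Suc.prems(1)] and gn = times_differentiable_SucD[OF Suc.prems(2)]
  from Suc.prems obtain f' g' where f': "\<And>t. (f has_vector_derivative f' t) (at t)" "times_differentiable n f'"
    and g': "\<And>t. (g has_vector_derivative g' t) (at t)" "times_differentiable n g'" by auto
  have "((\<lambda>t. h (f t) (g t)) has_vector_derivative h (f t) (g' t) + h (f' t) (g t)) (at t)" for t
    by (rule bounded_bilinear.has_vector_derivative[OF h f'(1) g'(1)])
  moreover have "times_differentiable n (\<lambda>t. h (f t) (g' t) + h (f' t) (g t))"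
    by (intro times_differentiable_add Suc.IH fn gn f' g')
  ultimately show ?case by (rule times_differentiable_SucI)
qed simp

lemma times_differentiable_powr:
  fixes f :: "real \<Rightarrow> real"
  assumes "\<And>t. f t > 0"
  shows "times_differentiable n f \<Longrightarrow> times_differentiable n (\<lambda>t. f t powr a)"
proof (induction n arbitrary: a)
  case (Suc n)
  note fn = times_differentiable_SucD[OF Suc.prems]
  from Suc.prems obtain f' where f': "\<And>t. (f has_vector_derivative f' t) (at t)" "times_differentiable n f'"
    by auto
  have "((\<lambda>t. f t powr a) has_vector_derivative a * f t powr (a - 1) * f' t) (at t)" for t
    using DERIV_chain2[OF has_real_derivative_powr[OF assms, of a] f'(1)[folded has_real_derivative_iff_has_vector_derivative]]
    by (simp add: has_real_derivative_iff_has_vector_derivative)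
  moreover have "times_differentiable n (\<lambda>t. a * f t powr (a - 1) * f' t)"
    by (intro times_differentiable_bilinear[OF bounded_bilinear_mult] times_differentiable_const Suc.IH fn f')
  ultimately show ?case by (rule times_differentiable_SucI)
qed simp

lemma times_differentiable_force:
  assumes "times_differentiable n A" "\<And>t. det (A t) > 0"
  shows "times_differentiable n (\<lambda>t. force \<gamma> (A t))"
proof -
  have cof: "times_differentiable n (\<lambda>t. cof (A t))"
    unfolding cof_def by (intro times_differentiable_bilinear[OF bounded_bilinear_polar_cof] assms)
  have "times_differentiable n (\<lambda>t. (cof (A t) \<bullet> A t) * (1/3))"
    by (intro times_differentiable_bilinear[OF bounded_bilinear_mult] times_differentiable_const
        times_differentiable_bilinear[OF bounded_bilinear_inner] cof assms)
  then have "times_differentiable n (\<lambda>t. det (A t))" by (simp add: det_eq_cof_inner)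
  then show ?thesis
    unfolding force_def
    by (intro times_differentiable_bilinear[OF bounded_bilinear_scaleR] times_differentiable_powr assms cof)
qed

text \<open>
  Bootstrapping: if \<open>A\<close> and \<open>A' = V\<close> are \<open>n\<close> times differentiable, then so is \<open>V' = F A\<close>.
\<close>

lemma solution_times_differentiable:
  assumes sol: "solution_on \<gamma> UNIV A V"
  shows "times_differentiable n A \<and> times_differentiable n V"
proof (induction n)
  case (Suc n)
  have "times_differentiable n (\<lambda>t. force \<gamma> (A t))"
    using Suc solution_onD(1)[OF sol] by (intro times_differentiable_force) auto
  then have "times_differentiable (Suc n) V"
    by (rule times_differentiable_SucI[OF solution_onD(3)[OF sol UNIV_I]])
  moreover have "times_differentiable (Suc n) A"
    by (rule times_differentiable_SucI[OF solution_onD(2)[OF sol UNIV_I] conjunct2[OF Suc]])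
  ultimately show ?case by blast
qed simp

lemma C_infinityI:
  assumes "\<And>n. times_differentiable n f"
  shows "C_infinity f"
proof -
  have step: "times_differentiable n (vderiv f)" if n: "times_differentiable (Suc n) f" for n and f :: "real \<Rightarrow> 'a"
  proof -
    obtain f' where f': "\<And>t. (f has_vector_derivative f' t) (at t)" "times_differentiable n f'"
      using n by auto
    have "vderiv f = f'"
      using f'(1) by (rule vderiv_eqI)
    then show ?thesis using f'(2) by simp
  qed
  have all: "times_differentiable m ((vderiv ^^ k) f)" for k m
    using assms by (induction k arbitrary: m) (simp_all del: times_differentiable.simps add: step)
  have "(vderiv ^^ k) f differentiable (at t)" for k t
    using all[of "Suc 0" k] differentiableI_vector unfolding times_differentiable.simps by blast
  then show ?thesis by (simp add: C_infinity_def)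
qed

text \<open>
  Passes between the second-order formulation with iterated derivatives and the first-order system for position
  and velocity.
\<close>

lemma solution_iff:
  "continuous_on UNIV A \<and> range A \<subseteq> GL_pos \<and> C_infinity A \<and>
    (\<forall>t. (vderiv ^^ 2) A t = (det (A t) powr (1 - \<gamma>)) *\<^sub>R inverse_transpose (A t))
   \<longleftrightarrow> (\<exists>V. solution_on \<gamma> UNIV A V)" (is "?L \<longleftrightarrow> ?R")
proof
  assume L: ?L
  have "(vderiv ^^ 0) A differentiable (at t)" for t
    using L unfolding C_infinity_def by blast
  then have 0: "(A has_vector_derivative vderiv A t) (at t)" for t
    by (simp add: vderiv_def vector_derivative_works[symmetric])
  have "(vderiv ^^ 1) A differentiable (at t)" for t
    using L unfolding C_infinity_def by blast
  then have "(vderiv A has_vector_derivative vderiv (vderiv A) t) (at t)" for t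
    by (simp add: vderiv_def[of "vderiv A"] vector_derivative_works[symmetric])
  moreover have pos: "det (A t) > 0" for t using L by (auto simp: GL_pos_def)
  moreover have "vderiv (vderiv A) t = force \<gamma> (A t)" for t
    using L pos by (simp add: numeral_2_eq_2 force_eq_inverse_transpose)
  ultimately have "solution_on \<gamma> UNIV A (vderiv A)" using 0 by (simp add: solution_on_def)
  then show ?R by blast
next
  assume ?R
  then obtain V where sol: "solution_on \<gamma> UNIV A V" by blast
  note D = solution_onD[OF sol UNIV_I]
  have "vderiv A = V" "vderiv V = (\<lambda>t. force \<gamma> (A t))"
    by (rule vderiv_eqI, rule D)+
  then have "\<forall>t. (vderiv ^^ 2) A t = (det (A t) powr (1 - \<gamma>)) *\<^sub>R inverse_transpose (A t)"
    using D(1) by (simp add: numeral_2_eq_2 force_eq_inverse_transpose)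
  moreover have "continuous_on UNIV A"
    by (rule has_vector_derivative_imp_continuous_on) (rule D)
  moreover have "C_infinity A"
    using solution_times_differentiable[OF sol] by (intro C_infinityI) blast
  ultimately show ?L using D(1) by (auto simp: GL_pos_def)
qed

text \<open>
  The operator norm lies between the largest absolute value of an entry and the sum of the absolute values.
\<close>

lemma tendsto_opnorm_iff:
  "((\<lambda>t. opnorm (M t)) \<longlongrightarrow> 0) F \<longleftrightarrow> (M \<longlongrightarrow> 0) F"
proof
  assume op: "((\<lambda>t. opnorm (M t)) \<longlongrightarrow> 0) F"
  have "norm (M t $ i $ j) \<le> opnorm (M t)" for t i j
    unfolding opnorm_def real_norm_def by (rule matrix_component_le_onorm)
  then have "((\<lambda>t. M t $ i $ j) \<longlongrightarrow> 0 $ i $ j) F" for i j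
    unfolding zero_index by (rule Lim_null_comparison[OF always_eventually[OF allI] op])
  then show "(M \<longlongrightarrow> 0) F"
    by (intro vec_tendstoI)
next
  assume M: "(M \<longlongrightarrow> 0) F"
  have "((\<lambda>t. \<bar>M t $ i $ j\<bar>) \<longlongrightarrow> 0) F" for i j
    using tendsto_rabs[OF tendsto_vec_nth[OF tendsto_vec_nth[OF M]], of i j] by simp
  then have "((\<lambda>t. \<Sum>i\<in>UNIV. \<Sum>j\<in>UNIV. \<bar>M t $ i $ j\<bar>) \<longlongrightarrow> 0) F"
    by (intro tendsto_null_sum)
  moreover have "norm (opnorm (M t)) \<le> (\<Sum>i\<in>UNIV. \<Sum>j\<in>UNIV. \<bar>M t $ i $ j\<bar>)" for t
    using onorm_le_matrix_component_sum[of "M t"] onorm_pos_le[OF matrix_vector_mul_bounded_linear[of "M t"]]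
    by (simp add: opnorm_def)
  ultimately show "((\<lambda>t. opnorm (M t)) \<longlongrightarrow> 0) F"
    by (rule Lim_null_comparison[OF always_eventually[OF allI], rotated])
qed

theorem corollary1:
  fixes A0 A1 :: "real^3^3" and \<gamma> :: real
  assumes "filterlim (\<lambda>t::real. det (A0 + t *\<^sub>R A1)) at_top at_top"
    and "\<gamma> > 5"
  shows "\<exists>!A :: real \<Rightarrow> real^3^3.
    continuous_on UNIV A \<and> range A \<subseteq> GL_pos \<and> C_infinity A \<and>
    (\<forall>t. (vderiv ^^ 2) A t = (det (A t) powr (1 - \<gamma>)) *\<^sub>R inverse_transpose (A t)) \<and>
    ((\<lambda>t. opnorm (A t - (A0 + t *\<^sub>R A1))) \<longlongrightarrow> 0) at_top"
proof -
  obtain k where k: "k > 0" and growth: "\<forall>\<^sub>F t in at_top. det (A0 + t *\<^sub>R A1) \<ge> k * t"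
    using cubic_at_top_lower_bound[OF assms(1)[unfolded det_affine]] unfolding det_affine by blast
  define asymptotic where "asymptotic A \<longleftrightarrow> ((\<lambda>t. A t - (A0 + t *\<^sub>R A1)) \<longlongrightarrow> 0) at_top" for A
  have "\<exists>!A. (\<exists>V. solution_on \<gamma> UNIV A V) \<and> asymptotic A"
  proof (rule ex_ex1I)
    obtain T B W where B: "solution_on \<gamma> {T..} B W" "asymptotic B"
      using exists_asymptotic_solution[OF \<open>\<gamma> > 5\<close> k growth] unfolding asymptotic_def by blast
    have "\<gamma> > 1" using \<open>\<gamma> > 5\<close> by simp
    moreover have "det (B T) > 0" using solution_onD(1)[OF B(1)] by simp
    ultimately obtain A V where A: "A T = B T" "V T = W T" "solution_on \<gamma> UNIV A V"
      by (rule global_solution)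
    have "A t = B t" if "t \<ge> T" for t
    proof (rule solutions_agree(1)[of \<gamma> T t A V B W T t])
      show "solution_on \<gamma> {T..t} A V" "solution_on \<gamma> {T..t} B W"
        by (rule solution_on_subset[OF A(3)] solution_on_subset[OF B(1)]; auto)+
    qed (use A(1,2) that \<open>\<gamma> > 5\<close> in auto)
    then have "\<forall>\<^sub>F t in at_top. B t - (A0 + t *\<^sub>R A1) = A t - (A0 + t *\<^sub>R A1)"
      by (intro eventually_mono[OF eventually_ge_at_top[of T]]) simp
    then have "asymptotic A"
      unfolding asymptotic_def by (rule Lim_transform_eventually[OF B(2)[unfolded asymptotic_def]])
    then show "\<exists>A. (\<exists>V. solution_on \<gamma> UNIV A V) \<and> asymptotic A" using A(3) by blast
  next
    fix A C
    assume "(\<exists>V. solution_on \<gamma> UNIV A V) \<and> asymptotic A" "(\<exists>V. solution_on \<gamma> UNIV C V) \<and> asymptotic C"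
    then obtain V W where A: "solution_on \<gamma> UNIV A V" "asymptotic A" and C: "solution_on \<gamma> UNIV C W" "asymptotic C"
      by blast
    have "\<forall>\<^sub>F t in at_top. A t = C t"
      using asymptotic_solutions_eventually_agree[OF \<open>\<gamma> > 5\<close> k growth, of 0 A V C W] A C
        solution_on_subset[OF A(1), of "{0..}"] solution_on_subset[OF C(1), of "{0..}"]
      by (simp add: asymptotic_def)
    then obtain s where s: "\<And>t. t \<ge> s \<Longrightarrow> A t = C t"
      unfolding eventually_at_top_linorder by blast
    \<comment> \<open>At an interior point of the half-line of agreement the velocities agree as well.\<close>
    define u where "u = s + 1"
    have "(A has_vector_derivative W u) (at u)"
      by (rule has_vector_derivative_transform_within_open[of C _ _ "{s<..}"])
        (use s solution_onD(2)[OF C(1)] in \<open>auto simp: u_def\<close>)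
    then have "V u = W u"
      using solution_onD(2)[OF A(1)] vector_derivative_unique_at by blast
    show "A = C"
    proof
      fix t
      show "A t = C t"
      proof (rule solutions_agree(1))
        show "solution_on \<gamma> {min t u..max t u} A V" "solution_on \<gamma> {min t u..max t u} C W"
          by (rule solution_on_subset[OF A(1) subset_UNIV] solution_on_subset[OF C(1) subset_UNIV])+
        show "A u = C u" using s[of u] by (simp add: u_def)
      qed (use \<open>V u = W u\<close> \<open>\<gamma> > 5\<close> in auto)
    qed
  qed
  moreover have "continuous_on UNIV A \<and> range A \<subseteq> GL_pos \<and> C_infinity A \<and>
    (\<forall>t. (vderiv ^^ 2) A t = (det (A t) powr (1 - \<gamma>)) *\<^sub>R inverse_transpose (A t)) \<and>
    ((\<lambda>t. opnorm (A t - (A0 + t *\<^sub>R A1))) \<longlongrightarrow> 0) at_top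
    \<longleftrightarrow> (\<exists>V. solution_on \<gamma> UNIV A V) \<and> asymptotic A" for A
    by (simp only: asymptotic_def tendsto_opnorm_iff solution_iff[symmetric] conj_assoc)
  ultimately show ?thesis by (simp only:)
qed

end
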